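(* Let $M$ be a connected orientable smooth $m$-manifold and let $f\colon M\to\mathbb R^m$ be a smooth proper map. Let $\mathcal B\subset M$ be the set of branch points of $f$, i.e. points at which $f$ fails to be a local homeomorphism. If $x_*\in M$ verifies (i) $\operatorname{Ker}Df(x_* )$ is odd-dimensional; (ii) there exists a direction $v\in T_{x_*}(M)$ such that the intrinsic second derivative $\partial^2_vf(x_* )\colon\operatorname{Ker}Df(x_* )\to\operatorname{Coker}Df(x_* )$ is an isomorphism, then $x_*$ is a branch point of $f$. Moreover, in every neighbourhood of $x_*$ there are two regular points $x_+$ and $x_-$ of $f$ belonging to different path components of $M\setminus\mathcal B$; equivalently, every path in $M$ from $x_+$ to $x_-$ must intersect $\mathcal B$.
   Context: A regular point of $f$ is a point where $Df$ is an isomorphism. Intrinsic derivative. Let $\psi\colon F\to F'$ be a morphism of smooth vector bundles over a manifold $M$, $x\in M$, $v\in T_x(M)$. Choose trivializations of $F,F'$ over a neighbourhood $U$ of $x$ with fibres $F_x,F'_x$, equal to the identity at $x$; in them $\psi$ becomes a smooth map $L\colon U\to\operatorname{Hom}(F_x,F'_x)$ with $L(x)=\psi_x$. With $l(t)=L(\exp(tv))$, where $\exp$ is any exponential map at $x$, the intrinsic derivative is $\partial_v\psi(x)=k\,\dot l(0)\,i\colon\operatorname{Ker}\psi_x\to\operatorname{Coker}\psi_x$, where $i\colon\operatorname{Ker}\psi_x\to F_x$ is the inclusion and $k\colon F'_x\to\operatorname{Coker}\psi_x$ the projection. It is independent of the choices. For a smooth map $f\colon M\to N$ regard $Df$ as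 a bundle morphism $T(M)\to f^*T(N)$; the intrinsic second derivative of $f$ at $x$ in the direction $v$ is $\partial_v^2f(x)=\partial_v(Df)(x)$. *)

theory Defs
  imports "HOL-Analysis.Analysis" "HOL-Library.Function_Algebras"
begin

section \<open>Smooth maps between open subsets of Euclidean spaces\<close>

text \<open>For open \<open>S\<close> in a finite-dimensional space this is the usual class \<open>C\<^sup>k\<close>: the derivative exists
  and all its evaluations at fixed vectors are of class \<open>C\<^sup>k\<^sup>-\<^sup>1\<close>.\<close>

primrec Ck_on :: "nat \<Rightarrow> 'a::euclidean_space set \<Rightarrow> ('a \<Rightarrow> 'b::euclidean_space) \<Rightarrow> bool" where
  "Ck_on 0 S f \<longleftrightarrow> continuous_on S f"
| "Ck_on (Suc k) S f \<longleftrightarrow>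
     (\<forall>x\<in>S. f differentiable (at x)) \<and> (\<forall>v. Ck_on k S (\<lambda>x. frechet_derivative f (at x) v))"

definition smooth_on :: "'a::euclidean_space set \<Rightarrow> ('a \<Rightarrow> 'b::euclidean_space) \<Rightarrow> bool" where
  "smooth_on S f \<longleftrightarrow> (\<forall>k. Ck_on k S f)"


section \<open>Smooth manifolds\<close>

text \<open>A chart is a pair of its domain and its coordinate map; the values of the coordinate map outside
  the domain are irrelevant.\<close>

type_synonym ('a, 'n) chart = "'a set \<times> ('a \<Rightarrow> real ^ 'n)"

abbreviation chart_inv :: "('a, 'n) chart \<Rightarrow> real ^ 'n \<Rightarrow> 'a" where
  "chart_inv c \<equiv> inv_into (fst c) (snd c)"

abbreviation transition :: "('a, 'n) chart \<Rightarrow> ('a, 'n) chart \<Rightarrow> real ^ 'n \<Rightarrow> real ^ 'n" where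
  "transition c c' \<equiv> snd c' \<circ> chart_inv c"

locale smooth_manifold =
  fixes M :: "'a topology" and A :: "('a, 'n::finite) chart set"
  assumes Hausdorff: "Hausdorff_space M"
    and second_countable: "second_countable M"
    and charts: "\<And>U \<phi>. (U, \<phi>) \<in> A \<Longrightarrow>
      openin M U \<and> open (\<phi> ` U) \<and> homeomorphic_map (subtopology M U) (top_of_set (\<phi> ` U)) \<phi>"
    and covering: "topspace M = (\<Union>c\<in>A. fst c)"
    and smooth_transitions: "\<And>c c'. c \<in> A \<Longrightarrow> c' \<in> A \<Longrightarrow>
      smooth_on (snd c ` (fst c \<inter> fst c')) (transition c c')"

text \<open>The atlas \<open>A\<close> need not be maximal, so an orientation is given by another atlas \<open>B\<close> of the same
  smooth structure.\<close>

definition orientable :: "'a topology \<Rightarrow> ('a, 'n::finite) chart set \<Rightarrow> bool" where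
  "orientable M A \<longleftrightarrow> (\<exists>B. smooth_manifold M B \<and> smooth_manifold M (A \<union> B) \<and>
     (\<forall>c\<in>B. \<forall>c'\<in>B. \<forall>y \<in> snd c ` (fst c \<inter> fst c').
        det (matrix (frechet_derivative (transition c c') (at y))) > 0))"

text \<open>Smoothness of \<open>f\<close> on the open subset \<open>U\<close> of the manifold.\<close>

definition smooth_map_on ::
    "('a, 'n::finite) chart set \<Rightarrow> 'a set \<Rightarrow> ('a \<Rightarrow> 'b::euclidean_space) \<Rightarrow> bool" where
  "smooth_map_on A U f \<longleftrightarrow> (\<forall>c\<in>A. smooth_on (snd c ` (fst c \<inter> U)) (f \<circ> chart_inv c))"


section \<open>Tangent spaces and differentials\<close>

instantiation "fun" :: (type, real_vector) real_vector
begin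

definition scaleR_fun :: "real \<Rightarrow> ('a \<Rightarrow> 'b) \<Rightarrow> 'a \<Rightarrow> 'b" where
  "scaleR_fun r f = (\<lambda>x. r *\<^sub>R f x)"

instance
  by standard (auto simp: scaleR_fun_def fun_eq_iff algebra_simps)

end

text \<open>A tangent vector at \<open>x\<close> is the family of its coordinate vectors in the charts around \<open>x\<close>,
  which transform under the derivatives of the coordinate changes. At all other arguments the family
  is set to 0, to make it unique.\<close>

type_synonym ('a, 'n) tangent_vec = "('a, 'n) chart \<Rightarrow> real ^ 'n"

definition tangent_space :: "('a, 'n::finite) chart set \<Rightarrow> 'a \<Rightarrow> ('a, 'n) tangent_vec set" where
  "tangent_space A x = {u.
     (\<forall>c\<in>A. \<forall>c'\<in>A. x \<in> fst c \<longrightarrow> x \<in> fst c' \<longrightarrow>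
        u c' = frechet_derivative (transition c c') (at (snd c x)) (u c)) \<and>
     (\<forall>c. \<not> (c \<in> A \<and> x \<in> fst c) \<longrightarrow> u c = 0)}"

text \<open>By the chain rule the value does not depend on the selected chart; see
  \<open>differential_eq\<close> below. The tangent spaces of the Euclidean target are identified with
  the target itself.\<close>

definition differential ::
    "('a, 'n::finite) chart set \<Rightarrow> ('a \<Rightarrow> 'b::euclidean_space) \<Rightarrow> 'a \<Rightarrow> ('a, 'n) tangent_vec \<Rightarrow> 'b" where
  "differential A f x u =
     (let c = SOME c. c \<in> A \<and> x \<in> fst c
      in frechet_derivative (f \<circ> chart_inv c) (at (snd c x)) (u c))"

lemma smooth_on_differentiable: "smooth_on S f \<Longrightarrow> x \<in> S \<Longrightarrow> f differentiable (at x)"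
  unfolding smooth_on_def by (drule spec[of _ "Suc 0"]) simp

context smooth_manifold
begin

lemma chart_inj:
  assumes "c \<in> A"
  shows "inj_on (snd c) (fst c)"
proof -
  have "fst c \<subseteq> topspace M"
    "homeomorphic_map (subtopology M (fst c)) (top_of_set (snd c ` fst c)) (snd c)"
    using charts[of "fst c" "snd c"] assms by (simp_all add: openin_subset)
  then show ?thesis
    by (auto dest!: homeomorphic_imp_injective_map simp: Int_absorb1)
qed

lemma chart_inv_left [simp]: "c \<in> A \<Longrightarrow> x \<in> fst c \<Longrightarrow> chart_inv c (snd c x) = x"
  by (rule inv_into_f_f[OF chart_inj])

lemma open_chart_image:
  assumes "c \<in> A" "openin M V" "V \<subseteq> fst c"
  shows "open (snd c ` V)"
proof -
  have c: "openin M (fst c)" "open (snd c ` fst c)"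
    "homeomorphic_map (subtopology M (fst c)) (top_of_set (snd c ` fst c)) (snd c)"
    using charts[of "fst c" "snd c"] assms(1) by auto
  have "openin (subtopology M (fst c)) V"
    using assms c(1) by (simp add: openin_open_subtopology)
  then have "openin (top_of_set (snd c ` fst c)) (snd c ` V)"
    using homeomorphic_imp_open_map[OF c(3)] by (simp add: open_map_def)
  then show ?thesis
    using openin_open_trans[OF _ c(2)] by simp
qed

lemma openin_chart: "c \<in> A \<Longrightarrow> openin M (fst c)"
  using charts[of "fst c" "snd c"] by simp

lemma open_chart_overlap: "c \<in> A \<Longrightarrow> c' \<in> A \<Longrightarrow> open (snd c ` (fst c \<inter> fst c'))"
  by (rule open_chart_image) (auto simp: openin_chart openin_Int)

lemma transition_differentiable:
  assumes "c \<in> A" "c' \<in> A" "x \<in> fst c" "x \<in> fst c'"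
  shows "transition c c' differentiable (at (snd c x))"
  using assms by (intro smooth_on_differentiable[OF smooth_transitions]) auto

text \<open>A function read in one chart is, near \<open>x\<close>, its reading in another chart composed with the
  coordinate change, so that its derivative obeys the chain rule.\<close>

lemma frechet_derivative_change_chart:
  fixes h :: "'a \<Rightarrow> 'b::euclidean_space"
  assumes c: "c \<in> A" "c' \<in> A" "x \<in> fst c" "x \<in> fst c'"
    and h: "(h \<circ> chart_inv c') differentiable (at (snd c' x))"
  shows "frechet_derivative (h \<circ> chart_inv c) (at (snd c x)) w =
    frechet_derivative (h \<circ> chart_inv c') (at (snd c' x))
      (frechet_derivative (transition c c') (at (snd c x)) w)"
proof -
  let ?S = "snd c ` (fst c \<inter> fst c')"
  have t: "transition c c' (snd c x) = snd c' x"
    using c by simp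
  have d1: "(transition c c' has_derivative frechet_derivative (transition c c') (at (snd c x)))
      (at (snd c x))"
    using transition_differentiable[OF c] frechet_derivative_works by blast
  have d2: "(h \<circ> chart_inv c' has_derivative frechet_derivative (h \<circ> chart_inv c') (at (snd c' x)))
      (at (transition c c' (snd c x)))"
    unfolding t using h frechet_derivative_works by blast
  have "((h \<circ> chart_inv c') \<circ> transition c c' has_derivative
      frechet_derivative (h \<circ> chart_inv c') (at (snd c' x)) \<circ>
      frechet_derivative (transition c c') (at (snd c x))) (at (snd c x))"
    by (rule diff_chain_at[OF d1 d2])
  then have "(h \<circ> chart_inv c has_derivative
      frechet_derivative (h \<circ> chart_inv c') (at (snd c' x)) \<circ>
      frechet_derivative (transition c c') (at (snd c x))) (at (snd c x))"
    by (rule has_derivative_transform_within_open[where s = ?S])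
      (use c in \<open>auto simp: open_chart_overlap\<close>)
  then show ?thesis
    by (simp flip: frechet_derivative_at)
qed

lemma differential_eq:
  fixes f :: "'a \<Rightarrow> 'b::euclidean_space"
  assumes f: "smooth_map_on A (topspace M) f"
    and c: "c \<in> A" "x \<in> fst c" and u: "u \<in> tangent_space A x"
  shows "differential A f x u = frechet_derivative (f \<circ> chart_inv c) (at (snd c x)) (u c)"
proof -
  define c0 where "c0 = (SOME c. c \<in> A \<and> x \<in> fst c)"
  have c0: "c0 \<in> A" "x \<in> fst c0"
    unfolding c0_def using someI[of "\<lambda>c. c \<in> A \<and> x \<in> fst c" c] c by auto
  have "(f \<circ> chart_inv c) differentiable (at (snd c x))"
  proof (rule smooth_on_differentiable)
    show "smooth_on (snd c ` (fst c \<inter> topspace M)) (f \<circ> chart_inv c)"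
      using f c by (simp add: smooth_map_on_def)
    show "snd c x \<in> snd c ` (fst c \<inter> topspace M)"
      using c covering by blast
  qed
  from frechet_derivative_change_chart[OF c0(1) c(1) c0(2) c(2) this, of "u c0"]
  have "frechet_derivative (f \<circ> chart_inv c0) (at (snd c0 x)) (u c0) =
      frechet_derivative (f \<circ> chart_inv c) (at (snd c x))
        (frechet_derivative (transition c0 c) (at (snd c0 x)) (u c0))" .
  also have "frechet_derivative (transition c0 c) (at (snd c0 x)) (u c0) = u c"
    using u c c0 unfolding tangent_space_def by (smt (verit, best) mem_Collect_eq)
  finally show ?thesis
    by (simp only: differential_def c0_def Let_def)
qed

lemma bij_betw_tangent_coordinates:
  assumes c: "c \<in> A" "x \<in> fst c"
  shows "bij_betw (\<lambda>u. u c) (tangent_space A x) UNIV"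
proof (rule bij_betwI')
  fix u v assume uv: "u \<in> tangent_space A x" "v \<in> tangent_space A x"
  show "(u c = v c) = (u = v)"
  proof
    assume eq: "u c = v c"
    show "u = v"
    proof
      fix c' show "u c' = v c'"
      proof (cases "c' \<in> A \<and> x \<in> fst c'")
        case True
        then have "u c' = frechet_derivative (transition c c') (at (snd c x)) (u c)"
          "v c' = frechet_derivative (transition c c') (at (snd c x)) (v c)"
          using uv c unfolding tangent_space_def by blast+
        then show ?thesis using eq by simp
      next
        case False
        then have "u c' = 0" "v c' = 0"
          using uv unfolding tangent_space_def by blast+
        then show ?thesis by simp
      qed
    qed
  qed simp
next
  fix w :: "real ^ 'n"
  define u where "u = (\<lambda>c'. if c' \<in> A \<and> x \<in> fst c'
    then frechet_derivative (transition c c') (at (snd c x)) w else 0)"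
  have chain: "frechet_derivative (transition c c'') (at (snd c x)) w =
      frechet_derivative (transition c' c'') (at (snd c' x))
        (frechet_derivative (transition c c') (at (snd c x)) w)"
    if "c' \<in> A" "c'' \<in> A" "x \<in> fst c'" "x \<in> fst c''" for c' c''
    using that c by (intro frechet_derivative_change_chart transition_differentiable) auto
  have "u \<in> tangent_space A x"
    unfolding tangent_space_def
  proof (intro CollectI conjI ballI impI allI)
    fix c' c'' assume "c' \<in> A" "c'' \<in> A" "x \<in> fst c'" "x \<in> fst c''"
    then show "u c'' = frechet_derivative (transition c' c'') (at (snd c' x)) (u c')"
      using chain[of c' c''] by (simp only: u_def simp_thms if_True)
  next
    fix c' assume "\<not> (c' \<in> A \<and> x \<in> fst c')"
    then show "u c' = 0"
      unfolding u_def by (rule if_not_P)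
  qed
  have "(transition c c has_derivative id) (at (snd c x))"
  proof (rule has_derivative_transform_within_open)
    show "(id has_derivative id) (at (snd c x))"
      unfolding id_def by (rule has_derivative_ident)
    show "open (snd c ` fst c)"
      using open_chart_overlap[OF c(1) c(1)] by simp
    show "snd c x \<in> snd c ` fst c"
      using c(2) by (rule imageI)
    show "id y = transition c c y" if "y \<in> snd c ` fst c" for y
      using f_inv_into_f[OF that] by simp
  qed
  then have "frechet_derivative (transition c c) (at (snd c x)) = id"
    by (simp flip: frechet_derivative_at)
  then have "u c = w"
    using c by (simp only: u_def simp_thms if_True id_apply)
  then show "\<exists>u\<in>tangent_space A x. w = u c"
    using \<open>u \<in> tangent_space A x\<close> by blast
qed simp

end


section \<open>Linear isomorphisms between subspaces and quotients\<close>

definition linear_iso_on ::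
    "'v::real_vector set \<Rightarrow> 'w::real_vector set \<Rightarrow> ('v \<Rightarrow> 'w) \<Rightarrow> bool" where
  "linear_iso_on V W h \<longleftrightarrow> bij_betw h V W \<and>
     (\<forall>u\<in>V. \<forall>v\<in>V. h (u + v) = h u + h v) \<and> (\<forall>r. \<forall>u\<in>V. h (r *\<^sub>R u) = r *\<^sub>R h u)"

text \<open>The elements of the quotient space \<open>V/S\<close> are the cosets \<open>w + S\<close> with \<open>w \<in> V\<close>; \<open>coset S\<close> is
  the projection.\<close>

definition coset :: "'v::real_vector set \<Rightarrow> 'v \<Rightarrow> 'v set" where
  "coset S w = {w + s |s. s \<in> S}"

definition quotient_space :: "'v::real_vector set \<Rightarrow> 'v set \<Rightarrow> 'v set set" where
  "quotient_space V S = coset S ` V"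

definition coset_add :: "'v::real_vector set \<Rightarrow> 'v set \<Rightarrow> 'v set" where
  "coset_add C D = {c + d |c d. c \<in> C \<and> d \<in> D}"

text \<open>The summand \<open>s\<close> is needed for \<open>r = 0\<close> only.\<close>

definition coset_scale :: "'v::real_vector set \<Rightarrow> real \<Rightarrow> 'v set \<Rightarrow> 'v set" where
  "coset_scale S r C = {r *\<^sub>R c + s |c s. c \<in> C \<and> s \<in> S}"

definition linear_iso_to_quotient ::
    "'u::real_vector set \<Rightarrow> 'v::real_vector set \<Rightarrow> 'v set \<Rightarrow> ('u \<Rightarrow> 'v set) \<Rightarrow> bool" where
  "linear_iso_to_quotient K V S D \<longleftrightarrow> bij_betw D K (quotient_space V S) \<and>
     (\<forall>u\<in>K. \<forall>v\<in>K. D (u + v) = coset_add (D u) (D v)) \<and>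
     (\<forall>r. \<forall>u\<in>K. D (r *\<^sub>R u) = coset_scale S r (D u))"


section \<open>Vector bundles and the intrinsic derivative\<close>

text \<open>A vector bundle is given by its fibres, which are subspaces of one ambient vector space, and by
  local trivializations \<open>(V, \<sigma>)\<close>, where \<open>\<sigma> y\<close> is a linear isomorphism of the fibre at \<open>y \<in> V\<close> onto
  the model fibre.\<close>

record ('a, 'e, 'k) vbundle =
  fibre :: "'a \<Rightarrow> 'e set"
  trivs :: "('a set \<times> ('a \<Rightarrow> 'e \<Rightarrow> 'k)) set"

definition tangent_bundle ::
    "('a, 'n::finite) chart set \<Rightarrow> ('a, ('a, 'n) tangent_vec, real ^ 'n) vbundle" where
  "tangent_bundle A = \<lparr>fibre = tangent_space A, trivs = {(fst c, \<lambda>y u. u c) |c. c \<in> A}\<rparr>"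

text \<open>The pullback to \<open>M\<close>, under any map, of the tangent bundle of a Euclidean space.\<close>

definition pullback_euclidean_tangent_bundle :: "'a topology \<Rightarrow> ('a, 'b, 'b::euclidean_space) vbundle" where
  "pullback_euclidean_tangent_bundle M = \<lparr>fibre = \<lambda>y. UNIV, trivs = {(topspace M, \<lambda>y w. w)}\<rparr>"

text \<open>A smooth trivialization \<open>\<tau>\<close> of \<open>F\<close> over the open neighbourhood \<open>U\<close> of \<open>x\<close>, with the fibre at
  \<open>x\<close> as its model fibre, and equal to the identity at \<open>x\<close>. Smoothness is expressed in the
  trivializations \<open>\<sigma>\<close> of the bundle and coordinates \<open>\<rho> x\<close> of the fibre at \<open>x\<close>.\<close>

definition trivialization_at ::
    "'a topology \<Rightarrow> ('a, 'n::finite) chart set \<Rightarrow> ('a, 'e::real_vector, 'k::euclidean_space) vbundle \<Rightarrow>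
     'a \<Rightarrow> 'a set \<Rightarrow> ('a \<Rightarrow> 'e \<Rightarrow> 'e) \<Rightarrow> bool" where
  "trivialization_at M A F x U \<tau> \<longleftrightarrow>
     openin M U \<and> x \<in> U \<and>
     (\<forall>y\<in>U. linear_iso_on (fibre F y) (fibre F x) (\<tau> y)) \<and>
     (\<forall>u \<in> fibre F x. \<tau> x u = u) \<and>
     (\<forall>(V, \<sigma>) \<in> trivs F. \<forall>(W, \<rho>) \<in> trivs F. x \<in> W \<longrightarrow>
        (\<forall>w. smooth_map_on A (U \<inter> V) (\<lambda>y. \<rho> x (\<tau> y (the_inv_into (fibre F y) (\<sigma> y) w)))))"

text \<open>An exponential map at \<open>x\<close> is a smooth map \<open>e\<close> into the manifold, defined near 0 in the tangent
  space at \<open>x\<close>, with \<open>e 0 = x\<close> and whose derivative at 0 is the identity. These are the only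
  properties of the exponential map of a connection on which the intrinsic derivative depends.\<close>

definition exponential_map_at ::
    "('a, 'n::finite) chart set \<Rightarrow> 'a \<Rightarrow> (('a, 'n) tangent_vec \<Rightarrow> 'a) \<Rightarrow> bool" where
  "exponential_map_at A x e \<longleftrightarrow> e 0 = x \<and>
     (\<forall>c\<in>A. x \<in> fst c \<longrightarrow>
        (let e' = e \<circ> the_inv_into (tangent_space A x) (\<lambda>u. u c)
         in \<exists>W. open W \<and> 0 \<in> W \<and> e' ` W \<subseteq> fst c \<and> smooth_on W (snd c \<circ> e') \<and>
              (snd c \<circ> e' has_derivative id) (at 0)))"

text \<open>\<open>D\<close> is the intrinsic derivative at \<open>x\<close> in the direction \<open>v\<close> of the bundle morphism
  \<open>\<psi>\<close>, given by linear maps \<open>\<psi> y\<close> from \<open>fibre F y\<close> to \<open>fibre F' y\<close>. Here \<open>ldot\<close> is the derivative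
  at 0 of \<open>l t = L (e (t v))\<close>, computed pointwise and in a coordinate system \<open>\<sigma> x\<close> of the fibre of \<open>F'\<close>.
  Only the restriction of \<open>D\<close> to the kernel is relevant.\<close>

definition has_intrinsic_derivative ::
    "'a topology \<Rightarrow> ('a, 'n::finite) chart set \<Rightarrow>
     ('a, 'e::real_vector, 'k::euclidean_space) vbundle \<Rightarrow>
     ('a, 'g::real_vector, 'l::euclidean_space) vbundle \<Rightarrow>
     ('a \<Rightarrow> 'e \<Rightarrow> 'g) \<Rightarrow> 'a \<Rightarrow> ('a, 'n) tangent_vec \<Rightarrow> ('e \<Rightarrow> 'g set) \<Rightarrow> bool" where
  "has_intrinsic_derivative M A F F' \<psi> x v D \<longleftrightarrow>
     (\<exists>U \<tau> \<tau>' e ldot.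
        trivialization_at M A F x U \<tau> \<and> trivialization_at M A F' x U \<tau>' \<and> exponential_map_at A x e \<and>
        (let L = (\<lambda>y u. \<tau>' y (\<psi> y (the_inv_into (fibre F y) (\<tau> y) u)));
             l = (\<lambda>t. L (e (t *\<^sub>R v)))
         in \<forall>u \<in> fibre F x. ldot u \<in> fibre F' x \<and>
              (\<forall>(V, \<sigma>) \<in> trivs F'. x \<in> V \<longrightarrow>
                 ((\<lambda>t. \<sigma> x (l t u)) has_vector_derivative \<sigma> x (ldot u)) (at 0))) \<and>
        (\<forall>u \<in> fibre F x. \<psi> x u = 0 \<longrightarrow> D u = coset (\<psi> x ` fibre F x) (ldot u)))"

definition has_intrinsic_second_derivative ::
    "'a topology \<Rightarrow> ('a, 'n::finite) chart set \<Rightarrow> ('a \<Rightarrow> 'b::euclidean_space) \<Rightarrow> 'a \<Rightarrow>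
     ('a, 'n) tangent_vec \<Rightarrow> (('a, 'n) tangent_vec \<Rightarrow> 'b set) \<Rightarrow> bool" where
  "has_intrinsic_second_derivative M A f x v D \<longleftrightarrow>
     has_intrinsic_derivative M A (tangent_bundle A) (pullback_euclidean_tangent_bundle M)
       (differential A f) x v D"


section \<open>Regular points and branch points\<close>

definition differential_kernel ::
    "('a, 'n::finite) chart set \<Rightarrow> ('a \<Rightarrow> 'b::euclidean_space) \<Rightarrow> 'a \<Rightarrow> ('a, 'n) tangent_vec set" where
  "differential_kernel A f x = {u \<in> tangent_space A x. differential A f x u = 0}"

definition differential_range ::
    "('a, 'n::finite) chart set \<Rightarrow> ('a \<Rightarrow> 'b::euclidean_space) \<Rightarrow> 'a \<Rightarrow> 'b set" where
  "differential_range A f x = differential A f x ` tangent_space A x"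

definition regular_point ::
    "'a topology \<Rightarrow> ('a, 'n::finite) chart set \<Rightarrow> ('a \<Rightarrow> 'b::euclidean_space) \<Rightarrow> 'a \<Rightarrow> bool" where
  "regular_point M A f x \<longleftrightarrow>
     x \<in> topspace M \<and> linear_iso_on (tangent_space A x) UNIV (differential A f x)"

definition local_homeomorphism_at ::
    "'a topology \<Rightarrow> 'b topology \<Rightarrow> ('a \<Rightarrow> 'b) \<Rightarrow> 'a \<Rightarrow> bool" where
  "local_homeomorphism_at X Y f x \<longleftrightarrow>
     (\<exists>U. openin X U \<and> x \<in> U \<and> openin Y (f ` U) \<and>
        homeomorphic_map (subtopology X U) (subtopology Y (f ` U)) f)"

definition branch_set :: "'a topology \<Rightarrow> ('a \<Rightarrow> 'b::euclidean_space) \<Rightarrow> 'a set" where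
  "branch_set M f = {x \<in> topspace M. \<not> local_homeomorphism_at M euclidean f x}"

end

theory Submission
  imports Defs "HOL-Homology.Brouwer_Degree"
begin

text \<open>An injective continuous map on a convex open subset of Euclidean space has the same orientation at
  all points where its derivative is invertible: for a point \<open>a\<close> the maps \<open>u \<mapsto> h (a + r u) - h a\<close> on
  the unit sphere avoid \<open>0\<close>, they are homotopic for all \<open>a\<close>, and for \<open>r \<rightarrow> 0\<close> they become the derivative
  at \<open>a\<close>, whose Brouwer degree is the sign of its determinant. So, in an oriented atlas, the sign
  of the Jacobian determinant is locally constant on the complement of the branch set, where by Sard's theorem
  it is determined on a dense set; it cannot change along a path that avoids the branch set.

  At \<open>x\<close>, let \<open>l t\<close> represent \<open>Df\<close> along a curve with velocity \<open>v\<close>, and let \<open>k\<close> be the dimension of the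
  kernel of \<open>l 0\<close>. Multiplying \<open>l t\<close> by \<open>1/t\<close> on this kernel gives a matrix which, by hypothesis, has an
  invertible limit. Hence \<open>det (l t) / t\<^sup>k\<close> has a nonzero limit, and as \<open>k\<close> is odd the determinant changes
  sign at \<open>t = 0\<close>.\<close>

section \<open>Degree of maps of the unit sphere\<close>

text \<open>The obstacle is that a non-branch point may be singular, as 0 is for the cube map on the
  line, so there the Jacobian has no sign of its own. The sign is therefore recorded by weak
  inequalities required on a whole neighbourhood. This gives two open sets, one for each sign. The
  degree argument shows that they cover the complement of the branch set. Sard's theorem shows that
  they do not meet there: on an overlap the Jacobian would vanish identically, although the map has
  an open image. The same dichotomy makes \<open>x\<close> a branch point, since both strict signs
  occur arbitrarily close to it.

  Two atlases are involved. The differential and the trivializations are given in \<open>A\<close>,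
  while a sign is meaningful globally only in the oriented atlas \<open>B\<close>. Near
  \<open>x\<close> they are compared through one transition, whose determinant keeps its sign. The
  trivializations are arbitrary, but they are the identity at \<open>x\<close>, so by continuity
  their determinants are positive nearby and do not affect the sign of \<open>det (l t)\<close> for
  small \<open>t\<close>.\<close>

definition coord_index :: "'n::finite \<Rightarrow> nat" where
  "coord_index = (SOME e. bij_betw e UNIV {..<CARD('n)})"

lemma bij_coord_index: "bij_betw (coord_index :: 'n::finite \<Rightarrow> nat) UNIV {..<CARD('n)}"
proof -
  have "\<exists>e :: 'n \<Rightarrow> nat. bij_betw e UNIV {..<CARD('n)}"
    using ex_bij_betw_finite_nat[of "UNIV :: 'n set"] by (simp add: atLeast0LessThan)
  then show ?thesis
    unfolding coord_index_def by (rule someI_ex)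
qed

text \<open>The Brouwer degree is defined on \<open>nsphere\<close>, whose points are sequences that
  vanish beyond the last coordinate; hence the padding by 0. Since \<open>'n\<close> carries no
  order, an arbitrary enumeration of the coordinates is fixed.\<close>

definition to_seq :: "real ^ 'n::finite \<Rightarrow> nat \<Rightarrow> real" where
  "to_seq v = (\<lambda>i. if i < CARD('n) then v $ (inv_into UNIV coord_index i) else 0)"

definition of_seq :: "(nat \<Rightarrow> real) \<Rightarrow> real ^ 'n::finite" where
  "of_seq y = (\<chi> j. y (coord_index j))"

lemma coord_index_less: "coord_index (j :: 'n::finite) < CARD('n)"
  using bij_coord_index bij_betwE by blast

lemma inv_coord_index [simp]: "inv_into UNIV coord_index (coord_index (j :: 'n::finite)) = j"
  using bij_coord_index by (meson bij_betw_imp_inj_on inv_f_f)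

lemma coord_index_inv: "i < CARD('n) \<Longrightarrow> coord_index (inv_into UNIV coord_index i :: 'n::finite) = i"
  using bij_coord_index[where 'n='n] by (metis bij_betw_imp_surj_on f_inv_into_f lessThan_iff)

lemma of_seq_to_seq [simp]: "of_seq (to_seq v) = v"
  by (simp add: of_seq_def to_seq_def vec_eq_iff coord_index_less)

lemma to_seq_of_seq: "(\<And>i. i \<ge> CARD('n) \<Longrightarrow> y i = 0) \<Longrightarrow> to_seq (of_seq y :: real ^ 'n::finite) = y"
  by (auto simp: of_seq_def to_seq_def fun_eq_iff coord_index_inv)

text \<open>\<open>nsphere p\<close> has the \<open>p + 1\<close> coordinates
  \<open>0, ..., p\<close>, so the unit sphere of \<open>real ^ 'n\<close> corresponds to
  \<open>p = CARD('n) - 1\<close>. Positivity of the cardinality keeps the truncated subtraction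
  harmless.\<close>

lemma card_minus_one_less_iff: "CARD('n::finite) - 1 < i \<longleftrightarrow> CARD('n) \<le> i"
proof -
  have "CARD('n) > 0" by simp
  then show ?thesis by linarith
qed

lemma atMost_card_minus_one: "{..CARD('n::finite) - 1} = {..<CARD('n)}"
  by (auto simp: not_less[symmetric] card_minus_one_less_iff simp del: One_nat_def)

lemma norm_of_seq: "norm (of_seq y :: real ^ 'n::finite) = sqrt (\<Sum>i\<le>CARD('n) - 1. (y i)\<^sup>2)"
proof -
  have "(\<Sum>j\<in>(UNIV :: 'n set). (y (coord_index j))\<^sup>2) = (\<Sum>i<CARD('n). (y i)\<^sup>2)"
    by (rule sum.reindex_bij_betw[OF bij_coord_index])
  then show ?thesis
    by (simp add: norm_vec_def L2_set_def of_seq_def atMost_card_minus_one del: One_nat_def)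
qed

lemma to_seq_mem_nsphere:
  fixes v :: "real ^ 'n::finite"
  assumes "norm v = 1"
  shows "to_seq v \<in> topspace (nsphere (CARD('n) - 1))"
proof -
  have "sqrt (\<Sum>i\<le>CARD('n) - 1. (to_seq v i)\<^sup>2) = 1"
    using norm_of_seq[of "to_seq v", where 'n='n] assms by simp
  moreover have "to_seq v i = 0" if "i > CARD('n) - 1" for i
    using that by (simp add: to_seq_def)
  ultimately show ?thesis
    by (simp add: nsphere)
qed

lemma of_seq_mem_sphere:
  assumes "y \<in> topspace (nsphere (CARD('n) - 1))"
  shows "norm (of_seq y :: real ^ 'n::finite) = 1" "to_seq (of_seq y :: real ^ 'n) = y"
  using assms by (auto simp: nsphere norm_of_seq card_minus_one_less_iff intro!: to_seq_of_seq simp del: One_nat_def)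

lemma continuous_map_of_seq:
  "continuous_map (nsphere (CARD('n) - 1)) (top_of_set (sphere 0 1)) (of_seq :: _ \<Rightarrow> real ^ 'n::finite)"
proof -
  have "continuous_map (nsphere (CARD('n) - 1)) euclidean (of_seq :: _ \<Rightarrow> real ^ 'n::finite)"
    unfolding nsphere euclidean_product_topology of_seq_def
    by (auto intro!: continuous_intros continuous_on_subset[OF continuous_on_product_coordinates])
  then show ?thesis
    by (auto simp: continuous_map_in_subtopology of_seq_mem_sphere)
qed

lemma continuous_map_to_seq:
  "continuous_map (top_of_set (sphere 0 1)) (nsphere (CARD('n) - 1)) (to_seq :: real ^ 'n::finite \<Rightarrow> _)"
proof -
  have "continuous_on (sphere 0 1) (to_seq :: real ^ 'n::finite \<Rightarrow> _)"
  proof (rule continuous_on_coordinatewise_then_product)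
    fix i
    show "continuous_on (sphere 0 1) (\<lambda>v :: real ^ 'n. to_seq v i)"
      by (cases "i < CARD('n)") (simp_all add: to_seq_def continuous_intros)
  qed
  moreover have "to_seq v \<in> topspace (nsphere (CARD('n) - 1))" if "v \<in> sphere 0 1" for v :: "real ^ 'n"
    using that to_seq_mem_nsphere by auto
  ultimately show ?thesis
    by (auto simp: nsphere continuous_map_in_subtopology euclidean_product_topology)
qed

text \<open>\<open>sgn\<close> is the radial projection onto the sphere. With it built in, maps and
  homotopies only have to avoid 0 and need not stay on the sphere.\<close>

definition sphere_map :: "(real ^ 'n::finite \<Rightarrow> real ^ 'n) \<Rightarrow> (nat \<Rightarrow> real) \<Rightarrow> nat \<Rightarrow> real" where
  "sphere_map T y = to_seq (sgn (T (of_seq y)))"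

definition sphere_degree :: "(real ^ 'n::finite \<Rightarrow> real ^ 'n) \<Rightarrow> int" where
  "sphere_degree T = Brouwer_degree2 (CARD('n) - 1) (sphere_map T)"

lemma sphere_degree_homotopy:
  fixes H :: "real \<Rightarrow> real ^ 'n::finite \<Rightarrow> real ^ 'n"
  assumes cont: "continuous_on ({0..1} \<times> sphere 0 1) (\<lambda>(t, u). H t u)"
    and nz: "\<And>t u. t \<in> {0..1} \<Longrightarrow> norm u = 1 \<Longrightarrow> H t u \<noteq> 0"
  shows "sphere_degree (H 0) = sphere_degree (H 1)"
proof -
  let ?p = "CARD('n) - 1"
  let ?h = "\<lambda>(t, y). sphere_map (H t) y"
  let ?I = "top_of_set {0..1::real}"
  have 1: "continuous_map (prod_topology ?I (nsphere ?p)) (prod_topology ?I (top_of_set (sphere 0 1)))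
      (\<lambda>(t, y). (t, of_seq y :: real ^ 'n))"
    using continuous_map_of_seq[where 'n='n] by (intro continuous_map_prod_top[THEN iffD2]) auto
  have "continuous_on ({0..1} \<times> sphere 0 1) (\<lambda>z. sgn (case z of (t, u) \<Rightarrow> H t u))"
    unfolding sgn_div_norm using nz by (intro continuous_intros cont) auto
  then have "continuous_map (top_of_set ({0..1} \<times> sphere 0 1)) (top_of_set (sphere 0 1)) (\<lambda>(t, u). sgn (H t u))"
    using nz by (auto simp: continuous_map_in_subtopology case_prod_unfold norm_sgn)
  then have 2: "continuous_map (prod_topology ?I (top_of_set (sphere 0 1))) (top_of_set (sphere 0 1)) (\<lambda>(t, u). sgn (H t u))"
    by (simp add: prod_topology_subtopology_eu)
  have "continuous_map (prod_topology ?I (nsphere ?p)) (nsphere ?p)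
     (to_seq \<circ> ((\<lambda>(t, u). sgn (H t u)) \<circ> (\<lambda>(t, y). (t, of_seq y :: real ^ 'n))))"
    by (intro continuous_map_compose[OF _ continuous_map_to_seq] continuous_map_compose[OF 1 2])
  moreover have "to_seq \<circ> ((\<lambda>(t, u). sgn (H t u)) \<circ> (\<lambda>(t, y). (t, of_seq y :: real ^ 'n))) = ?h"
    by (auto simp: fun_eq_iff sphere_map_def)
  ultimately have "continuous_map (prod_topology ?I (nsphere ?p)) (nsphere ?p) ?h"
    by simp
  then have "homotopic_with (\<lambda>x. True) (nsphere ?p) (nsphere ?p) (sphere_map (H 0)) (sphere_map (H 1))"
    unfolding homotopic_with_def by (intro exI[of _ ?h]) auto
  then show ?thesis
    unfolding sphere_degree_def by (rule Brouwer_degree2_homotopic)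
qed

lemma continuous_map_sphere_map:
  fixes T :: "real ^ 'n::finite \<Rightarrow> real ^ 'n"
  assumes "continuous_on (sphere 0 1) T" "\<And>u. norm u = 1 \<Longrightarrow> T u \<noteq> 0"
  shows "continuous_map (nsphere (CARD('n) - 1)) (nsphere (CARD('n) - 1)) (sphere_map T)"
proof -
  have "continuous_on (sphere 0 1) (\<lambda>u. sgn (T u))"
    unfolding sgn_div_norm using assms by (intro continuous_intros) auto
  then have "continuous_map (top_of_set (sphere 0 1)) (top_of_set (sphere 0 1)) (\<lambda>u. sgn (T u))"
    using assms by (auto simp: continuous_map_in_subtopology norm_sgn)
  then have "continuous_map (nsphere (CARD('n) - 1)) (nsphere (CARD('n) - 1)) (to_seq \<circ> ((\<lambda>u. sgn (T u)) \<circ> of_seq))"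
    by (intro continuous_map_compose[OF _ continuous_map_to_seq] continuous_map_compose[OF continuous_map_of_seq])
  then show ?thesis
    by (simp add: sphere_map_def[abs_def] comp_def)
qed

text \<open>Linearity enters through positive homogeneity: \<open>S\<close> carries the normalizing
  factor of \<open>T u\<close> outside, where the outer \<open>sgn\<close> absorbs it. On the sphere
  \<open>sphere_map\<close> thus respects composition, and multiplicativity of the Brouwer degree
  applies.\<close>

lemma sphere_degree_compose:
  fixes S T :: "real ^ 'n::finite \<Rightarrow> real ^ 'n"
  assumes S: "linear S" "inj S" and T: "linear T" "inj T"
  shows "sphere_degree (S \<circ> T) = sphere_degree S * sphere_degree T"
proof -
  have nz: "S u \<noteq> 0" "T u \<noteq> 0" if "norm u = 1" for u
    using that S T linear_injective_0 by force+
  have cont: "continuous_on (sphere 0 1) S" "continuous_on (sphere 0 1) T"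
    using S(1) T(1) by (auto intro!: linear_continuous_on simp flip: linear_conv_bounded_linear)
  have "sphere_map (S \<circ> T) y = (sphere_map S \<circ> sphere_map T) y" if "y \<in> topspace (nsphere (CARD('n) - 1))" for y
  proof -
    let ?u = "of_seq y :: real ^ 'n"
    have "sgn (S (sgn (T ?u))) = sgn (S (T ?u))"
      using nz(2)[of ?u] of_seq_mem_sphere(1)[OF that] linear_cmul[OF S(1)]
      by (simp add: sgn_div_norm linear_cmul)
    then show ?thesis
      by (simp add: sphere_map_def)
  qed
  then have "sphere_degree (S \<circ> T) = Brouwer_degree2 (CARD('n) - 1) (sphere_map S \<circ> sphere_map T)"
    unfolding sphere_degree_def by (rule Brouwer_degree2_eq)
  also have "\<dots> = sphere_degree S * sphere_degree T"
    unfolding sphere_degree_def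
    by (intro Brouwer_degree2_compose continuous_map_sphere_map cont nz)
  finally show ?thesis .
qed

lemma sphere_degree_id: "sphere_degree (\<lambda>x :: real ^ 'n::finite. x) = 1"
proof -
  have "sphere_map (\<lambda>x :: real ^ 'n. x) y = id y" if "y \<in> topspace (nsphere (CARD('n) - 1))" for y
    using of_seq_mem_sphere[OF that] by (simp add: sphere_map_def sgn_div_norm)
  then show ?thesis
    unfolding sphere_degree_def using Brouwer_degree2_eq Brouwer_degree2_id by metis
qed

section \<open>Degrees of coordinate reflections, coordinate swaps and general linear maps\<close>

definition coord_flip :: "'n::finite set \<Rightarrow> real ^ 'n \<Rightarrow> real ^ 'n" where
  "coord_flip K x = (\<chi> i. if i \<in> K then - (x $ i) else x $ i)"

lemma linear_coord_flip: "linear (coord_flip K)"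
  by (auto simp: linear_iff coord_flip_def vec_eq_iff)

lemma coord_flip_coord_flip: "coord_flip J (coord_flip K x) = coord_flip ((J - K) \<union> (K - J)) x"
  by (auto simp: coord_flip_def vec_eq_iff)

lemma inj_coord_flip: "inj (coord_flip K)"
  by (rule inj_on_inverseI[of _ "coord_flip K"]) (simp add: coord_flip_coord_flip, simp add: coord_flip_def)

lemma norm_coord_flip [simp]: "norm (coord_flip K x) = norm x"
  by (auto simp: norm_vec_def L2_set_def coord_flip_def intro!: arg_cong[where f = sqrt] sum.cong)

text \<open>\<open>Brouwer_degree2_reflection\<close> negates the entry with index 0, which is why
  the coordinate enumerated as 0 is treated first.\<close>

lemma sphere_degree_flip_first: "sphere_degree (coord_flip {inv_into UNIV coord_index 0 :: 'n::finite}) = -1"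
proof -
  let ?k = "inv_into UNIV coord_index 0 :: 'n"
  have k: "coord_index ?k = 0"
    by (rule coord_index_inv) simp
  have kk: "i = ?k \<longleftrightarrow> coord_index i = 0" for i
    using k inv_coord_index[of i] by metis
  have "sphere_map (coord_flip {?k}) y = (\<lambda>i. if i = 0 then - y i else y i)"
    if "y \<in> topspace (nsphere (CARD('n) - 1))" for y
  proof -
    have n: "norm (coord_flip {?k} (of_seq y)) = 1"
      using of_seq_mem_sphere(1)[OF that] by simp
    have y: "y i = 0" if "i \<ge> CARD('n)" for i
      using \<open>y \<in> _\<close> that by (auto simp: nsphere card_minus_one_less_iff simp del: One_nat_def)
    have "coord_flip {?k} (of_seq y :: real ^ 'n) = of_seq (\<lambda>i. if i = 0 then - y i else y i)"
      using kk by (simp add: coord_flip_def of_seq_def vec_eq_iff)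
    moreover have "to_seq (of_seq (\<lambda>i. if i = 0 then - y i else y i) :: real ^ 'n) = (\<lambda>i. if i = 0 then - y i else y i)"
      by (rule to_seq_of_seq) (use y in auto)
    ultimately have "to_seq (coord_flip {?k} (of_seq y)) = (\<lambda>i. if i = 0 then - y i else y i)"
      by simp
    then show ?thesis
      using n by (simp add: sphere_map_def sgn_div_norm)
  qed
  then have "sphere_degree (coord_flip {?k}) = Brouwer_degree2 (CARD('n) - 1) (\<lambda>y i. if i = 0 then - y i else y i)"
    unfolding sphere_degree_def by (rule Brouwer_degree2_eq)
  then show ?thesis
    by (simp add: Brouwer_degree2_reflection)
qed

definition coord_swap :: "'n::finite \<Rightarrow> 'n \<Rightarrow> real ^ 'n \<Rightarrow> real ^ 'n" where
  "coord_swap m n x = (\<chi> i. x $ Transposition.transpose m n i)"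

lemma continuous_on_if_const:
  "(P \<Longrightarrow> continuous_on S f) \<Longrightarrow> (\<not> P \<Longrightarrow> continuous_on S g) \<Longrightarrow>
    continuous_on S (\<lambda>x. if P then f x else g x)"
  by (cases P) auto

lemma sphere_degree_swap:
  fixes m n :: "'n::finite"
  assumes "m \<noteq> n"
  shows "sphere_degree (coord_swap m n) = sphere_degree (coord_flip {n})"
proof -
  \<comment> \<open>\<open>H t\<close> is the reflection of the \<open>(m, n)\<close>-plane in the line of angle \<open>t * pi / 4\<close>.\<close>
  define H where "H t x = (\<chi> i. if i = m then cos (t * pi / 2) * x $ m + sin (t * pi / 2) * x $ n
     else if i = n then sin (t * pi / 2) * x $ m - cos (t * pi / 2) * x $ n else x $ i)"
    for t and x :: "real ^ 'n"
  \<comment> \<open>Each \<open>H t\<close> is a reflection, hence an involution fixing 0; this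
    excludes zeros on the sphere.\<close>
  have invol: "H t (H t x) = x" for t x
  proof -
    define s c where "s = sin (t * pi / 2)" and "c = cos (t * pi / 2)"
    have sc: "s\<^sup>2 + c\<^sup>2 = 1"
      by (simp add: s_def c_def)
    have "c * (c * a + s * b) + s * (s * a - c * b) = (s\<^sup>2 + c\<^sup>2) * a"
      "s * (c * a + s * b) - c * (s * a - c * b) = (s\<^sup>2 + c\<^sup>2) * b" for a b
      by (simp_all add: algebra_simps power2_eq_square)
    then have "c * (c * a + s * b) + s * (s * a - c * b) = a"
      "s * (c * a + s * b) - c * (s * a - c * b) = b" for a b
      by (simp_all add: sc)
    then show ?thesis
      using assms by (simp add: H_def vec_eq_iff s_def c_def)
  qed
  have H0: "H t 0 = 0" for t
    by (auto simp: H_def vec_eq_iff)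
  have "H t u \<noteq> 0" if "norm u = 1" for t u
    using invol[of t u] H0[of t] that by auto
  moreover have "continuous_on ({0..1} \<times> sphere 0 1) (\<lambda>(t, u). H t u)"
    unfolding H_def case_prod_unfold
    by (intro continuous_on_vec_lambda continuous_on_if_const continuous_intros) auto
  ultimately have "sphere_degree (H 0) = sphere_degree (H 1)"
    by (intro sphere_degree_homotopy) auto
  moreover have "H 0 = coord_flip {n}" "H 1 = coord_swap m n"
    using assms by (auto simp: H_def coord_flip_def coord_swap_def fun_eq_iff vec_eq_iff Transposition.transpose_def)
  ultimately show ?thesis by simp
qed

text \<open>A swap is symmetric in its two coordinates, and its degree equals that of the flip of
  either one. So every flip has the degree of the flip of the coordinate enumerated as 0.\<close>

lemma sphere_degree_flip_singleton: "sphere_degree (coord_flip {n :: 'n::finite}) = -1"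
proof (cases "n = inv_into UNIV coord_index 0")
  case False
  have "coord_swap n (inv_into UNIV coord_index 0 :: 'n) = coord_swap (inv_into UNIV coord_index 0) n"
    by (simp add: coord_swap_def[abs_def] transpose_commute)
  then show ?thesis
    using sphere_degree_swap[of n "inv_into UNIV coord_index 0"] sphere_degree_swap[of "inv_into UNIV coord_index 0" n]
      sphere_degree_flip_first False by metis
qed (simp add: sphere_degree_flip_first)

lemma sphere_degree_flip: "sphere_degree (coord_flip (K :: 'n::finite set)) = (-1) ^ card K"
proof -
  have "finite K" by simp
  then show ?thesis
  proof (induction K)
    case empty
    then show ?case
      using sphere_degree_id by (simp add: coord_flip_def[abs_def])
  next
    case (insert n K)
    have "{n} - K \<union> (K - {n}) = insert n K"
      using insert by auto
    then have "coord_flip (insert n K) = coord_flip {n} \<circ> coord_flip K"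
      by (simp add: fun_eq_iff coord_flip_coord_flip)
    then show ?case
      using insert sphere_degree_compose[OF linear_coord_flip inj_coord_flip linear_coord_flip inj_coord_flip, of "{n}" K]
      by (simp add: sphere_degree_flip_singleton del: o_apply comp_apply)
  qed
qed

lemma sgn_prod_real: "finite A \<Longrightarrow> sgn (\<Prod>i\<in>A. c i :: real) = (\<Prod>i\<in>A. sgn (c i))"
  by (induction A rule: finite_induct) (auto simp: sgn_mult)

text \<open>Both sides are multiplicative, so it suffices to check the elementary maps that generate
  all linear maps: diagonal maps, swaps and shears, with maps into a coordinate hyperplane for the
  singular ones.\<close>

theorem sphere_degree_linear:
  fixes f :: "real ^ 'n::finite \<Rightarrow> real ^ 'n"
  assumes "linear f" "det (matrix f) \<noteq> 0"
  shows "sphere_degree f = sgn (det (matrix f))"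
proof -
  \<comment> \<open>The induction also passes through singular maps, so nonsingularity is a premise
    of the induction predicate. A nonsingular composition has nonsingular factors.\<close>
  let ?P = "\<lambda>f. linear f \<longrightarrow> det (matrix f) \<noteq> 0 \<longrightarrow> sphere_degree f = sgn (det (matrix f))"
  have "?P f"
  proof (rule induct_linear_elementary[OF \<open>linear f\<close>, of ?P])
    fix f g :: "real ^ 'n \<Rightarrow> real ^ 'n"
    assume fg: "linear f" "linear g" "?P f" "?P g"
    show "?P (f \<circ> g)"
    proof (intro impI)
      assume nz: "det (matrix (f \<circ> g)) \<noteq> 0"
      then have "det (matrix f) \<noteq> 0" "det (matrix g) \<noteq> 0"
        by (auto simp: matrix_compose fg det_mul)
      then show "sphere_degree (f \<circ> g) = sgn (det (matrix (f \<circ> g)))"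
        using fg det_nz_iff_inj[OF fg(1)] det_nz_iff_inj[OF fg(2)]
        by (simp add: sphere_degree_compose matrix_compose det_mul sgn_mult)
    qed
  next
    fix f :: "real ^ 'n \<Rightarrow> real ^ 'n" and i
    assume f: "linear f" "\<And>x. f x $ i = 0"
    have "row i (matrix f) = 0"
      using f(2) by (simp add: row_def matrix_def vec_eq_iff)
    then show "?P f"
      using det_zero_row(2) by blast
  next
    fix c :: "'n \<Rightarrow> real"
    let ?f = "\<lambda>x :: real ^ 'n. \<chi> i. c i * x $ i"
    have det: "det (matrix ?f) = (\<Prod>i\<in>UNIV. c i)"
      by (subst det_diagonal) (auto simp: matrix_def axis_def)
    show "?P ?f"
    proof (intro impI)
      assume "det (matrix ?f) \<noteq> 0"
      then have c: "c i \<noteq> 0" for i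
        by (auto simp: det)
      \<comment> \<open>Each coefficient moves on a straight line from \<open>c i\<close> to its
        sign and never meets 0, which deforms the diagonal map into a coordinate flip.\<close>
      let ?H = "\<lambda>t (x :: real ^ 'n). \<chi> i. ((1 - t) * c i + t * sgn (c i)) * x $ i"
      have "?H t u \<noteq> 0" if t: "t \<in> {0..1}" and u: "norm u = 1" for t u
      proof -
        have "(1 - t) * c i + t * sgn (c i) = sgn (c i) * ((1 - t) * \<bar>c i\<bar> + t)" for i
          using c[of i] by (cases "c i > 0") (simp_all add: algebra_simps)
        moreover have "(1 - t) * \<bar>c i\<bar> + t > 0" for i
          using t c[of i] by (cases "t = 0") (auto intro: add_nonneg_pos)
        ultimately have "(1 - t) * c i + t * sgn (c i) \<noteq> 0" for i
          using c[of i] by (simp add: sgn_zero_iff less_imp_neq[symmetric])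
        moreover obtain i where "u $ i \<noteq> 0"
          using u by (metis norm_zero vec_eq_iff zero_index zero_neq_one)
        ultimately show ?thesis
          by (auto simp: vec_eq_iff)
      qed
      moreover have "continuous_on ({0..1} \<times> sphere 0 1) (\<lambda>(t, u). ?H t u)"
        unfolding case_prod_unfold by (intro continuous_on_vec_lambda continuous_on_if_const continuous_intros)
      ultimately have "sphere_degree (?H 0) = sphere_degree (?H 1)"
        by (intro sphere_degree_homotopy) auto
      moreover have "?H 1 = coord_flip {i. c i < 0}"
        using c by (auto simp: fun_eq_iff coord_flip_def vec_eq_iff sgn_real_def)
      moreover have "sgn (\<Prod>i\<in>UNIV. c i) = (-1) ^ card {i. c i < 0}"
      proof -
        have "sgn (\<Prod>i\<in>UNIV. c i) = (\<Prod>i\<in>UNIV. sgn (c i))"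
          by (rule sgn_prod_real) simp
        also have "\<dots> = (\<Prod>i\<in>UNIV. if i \<in> {i. c i < 0} then -1 else 1)"
          using c by (intro prod.cong) (auto simp: sgn_real_def)
        also have "\<dots> = (-1) ^ card {i. c i < 0}"
          by (simp add: prod.If_cases)
        finally show ?thesis .
      qed
      ultimately show "sphere_degree ?f = sgn (det (matrix ?f))"
        by (simp add: det sphere_degree_flip)
    qed
  next
    fix m n :: 'n
    assume "m \<noteq> n"
    have "Transposition.transpose m n permutes (UNIV :: 'n set)"
      by (rule permutes_swap_id) auto
    from det_permute_rows[OF this, of "mat 1 :: real ^ 'n ^ 'n"] \<open>m \<noteq> n\<close>
    have "det (\<chi> i. mat 1 $ Transposition.transpose m n i :: real ^ 'n ^ 'n) = -1"
      by (simp add: sign_swap_id)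
    moreover have "matrix (coord_swap m n) = (\<chi> i. mat 1 $ Transposition.transpose m n i :: real ^ 'n ^ 'n)"
      by (auto simp: matrix_def coord_swap_def mat_def axis_def vec_eq_iff)
    ultimately have "det (matrix (coord_swap m n)) = -1"
      by simp
    then show "?P (\<lambda>x. \<chi> i. x $ Transposition.transpose m n i)"
      using sphere_degree_swap[OF \<open>m \<noteq> n\<close>] by (simp add: sphere_degree_flip coord_swap_def[abs_def])
  next
    fix m n :: 'n
    assume mn: "m \<noteq> n"
    let ?f = "\<lambda>x :: real ^ 'n. \<chi> i. if i = m then x $ m + x $ n else x $ i"
    \<comment> \<open>The shears with factor \<open>t\<close> join the given shear to the identity
      through injective maps.\<close>
    let ?H = "\<lambda>t (x :: real ^ 'n). \<chi> i. if i = m then x $ m + t * x $ n else x $ i"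
    have "?H t u \<noteq> 0" if "norm u = 1" for t u
    proof
      assume "?H t u = 0"
      then have "u $ i = 0" for i
        using mn by (simp add: vec_eq_iff) (metis add.right_neutral mult_zero_right)
      then show False
        using that by (metis norm_zero vec_eq_iff zero_index zero_neq_one)
    qed
    moreover have "continuous_on ({0..1} \<times> sphere 0 1) (\<lambda>(t, u). ?H t u)"
      unfolding case_prod_unfold by (intro continuous_on_vec_lambda continuous_on_if_const continuous_intros)
    ultimately have "sphere_degree (?H 0) = sphere_degree (?H 1)"
      by (intro sphere_degree_homotopy) auto
    moreover have "?H 1 = ?f"
      by (auto simp: fun_eq_iff vec_eq_iff)
    moreover have "?H 0 = (\<lambda>x. x)"
      by (auto simp: fun_eq_iff vec_eq_iff)
    moreover have "det (matrix ?f) = 1"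
    proof -
      have "matrix ?f = (\<chi> k. if k = m then row m (mat 1) + 1 *s row n (mat 1) else row k (mat 1))"
        by (auto simp: matrix_def vec_eq_iff row_def mat_def axis_def)
      then show ?thesis
        using det_row_operation[OF mn, of "mat 1" 1] by simp
    qed
    ultimately show "?P ?f"
      by (simp add: sphere_degree_id)
  qed
  then show ?thesis
    using assms by blast
qed

lemma sphere_degree_scaleR:
  assumes "c > 0"
  shows "sphere_degree (\<lambda>u. c *\<^sub>R T u) = sphere_degree T"
proof -
  have "sphere_map (\<lambda>u. c *\<^sub>R T u) = sphere_map T"
    using assms by (simp add: fun_eq_iff sphere_map_def sgn_scaleR)
  then show ?thesis
    by (simp add: sphere_degree_def)
qed

section \<open>Orientation of injective maps\<close>

lemma sphere_degree_derivative:
  fixes h :: "real ^ 'n::finite \<Rightarrow> real ^ 'n"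
  assumes V: "open V" "continuous_on V h" "inj_on h V" and r: "r > 0" "cball a r \<subseteq> V"
    and D: "(h has_derivative D) (at a)" "det (matrix D) \<noteq> 0"
  shows "sphere_degree (\<lambda>u. h (a + r *\<^sub>R u) - h a) = sphere_degree D"
proof -
  have lin: "linear D"
    using D(1) has_derivative_linear by blast
  \<comment> \<open>\<open>e 0 = 0\<close> by division by zero, which makes \<open>e\<close> continuous at \<open>0\<close>.\<close>
  define e where "e w = (h (a + w) - h a - D w) /\<^sub>R norm w" for w
  have e_eq: "h (a + w) - h a = D w + norm w *\<^sub>R e w" for w
    by (cases "w = 0") (simp_all add: e_def linear_0[OF lin])
  define V0 where "V0 = (\<lambda>w. a + w) -` V"
  have V0: "open V0"
    unfolding V0_def by (intro continuous_open_vimage V continuous_intros)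
  have "continuous_on V0 e"
  proof (rule continuous_at_imp_continuous_on, rule ballI)
    fix w assume w: "w \<in> V0"
    show "isCont e w"
    proof (cases "w = 0")
      case True
      have "(\<lambda>w. norm (h (a + w) - h a - D w) / norm w) \<midarrow>0\<rightarrow> 0"
        using D(1) by (simp add: has_derivative_at)
      then have "e \<midarrow>0\<rightarrow> 0"
        by (intro tendsto_norm_zero_cancel[of e]) (simp add: e_def divide_inverse_commute)
      then show ?thesis
        using True by (simp add: isCont_def e_def)
    next
      case False
      have "continuous_on (V0 - {0}) e"
        unfolding e_def
        by (intro continuous_intros continuous_on_compose2[OF V(2)] linear_continuous_on
            linear_conv_bounded_linear[THEN iffD1] lin) (auto simp: V0_def)
      then show ?thesis
        using w False V0 by (simp add: continuous_on_eq_continuous_at open_delete)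
    qed
  qed
  \<comment> \<open>For \<open>s > 0\<close> and a unit vector \<open>u\<close> this is the
    difference quotient of \<open>h\<close> at \<open>a\<close> with increment
    \<open>(s * r) *\<^sub>R u\<close>, nonzero by injectivity of \<open>h\<close>. For
    \<open>s = 0\<close> it is \<open>D u\<close>, nonzero by invertibility of
    \<open>D\<close>.\<close>
  define H where "H s u = D u + e ((s * r) *\<^sub>R u)" for s u
  have ball: "(s * r) *\<^sub>R u \<in> V0" if "s \<in> {0..1}" "norm u = 1" for s u
    using that r by (auto simp: V0_def dist_norm subset_iff mult_left_le_one_le)
  have "H s u \<noteq> 0" if s: "s \<in> {0..1}" and u: "norm u = 1" for s u
  proof (cases "s = 0")
    case True
    have "inj D"
      using D(2) lin det_nz_iff_inj by blast
    then have "D u \<noteq> 0"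
      using u lin linear_injective_0 by force
    then show ?thesis
      using True by (simp add: H_def e_def)
  next
    case False
    have "(s * r) *\<^sub>R H s u = h (a + (s * r) *\<^sub>R u) - h a"
      using s u r by (simp add: e_eq H_def scaleR_add_right linear_cmul[OF lin])
    moreover have "h (a + (s * r) *\<^sub>R u) \<noteq> h a"
    proof -
      have "a + (s * r) *\<^sub>R u \<in> V" "a \<in> V"
        using ball[OF s u] r by (auto simp: V0_def)
      moreover have "(s * r) *\<^sub>R u \<noteq> 0"
        using False u r by auto
      ultimately show ?thesis
        using V(3) by (auto dest: inj_onD)
    qed
    ultimately show ?thesis
      by auto
  qed
  moreover have "continuous_on ({0..1} \<times> sphere 0 1) (\<lambda>(s, u). H s u)"
    unfolding H_def case_prod_unfold using ball
    by (intro continuous_intros continuous_on_compose2[OF \<open>continuous_on V0 e\<close>]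
        continuous_on_compose2[OF linear_continuous_on[OF linear_conv_bounded_linear[THEN iffD1, OF lin]]])
      auto
  ultimately have "sphere_degree (H 0) = sphere_degree (H 1)"
    by (intro sphere_degree_homotopy) auto
  moreover have "H 0 = D"
    by (simp add: H_def[abs_def] e_def)
  moreover have "sphere_degree (\<lambda>u. h (a + r *\<^sub>R u) - h a) = sphere_degree (H 1)"
  proof -
    have "sphere_map (\<lambda>u. h (a + r *\<^sub>R u) - h a) y = sphere_map (\<lambda>u. r *\<^sub>R H 1 u) y"
      if "y \<in> topspace (nsphere (CARD('n) - 1))" for y
      using of_seq_mem_sphere(1)[OF that] r
      by (simp add: sphere_map_def H_def e_eq linear_cmul[OF lin] scaleR_add_right)
    then have "sphere_degree (\<lambda>u. h (a + r *\<^sub>R u) - h a) = sphere_degree (\<lambda>u. r *\<^sub>R H 1 u)"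
      unfolding sphere_degree_def by (rule Brouwer_degree2_eq)
    then show ?thesis
      using sphere_degree_scaleR[OF r(1)] by metis
  qed
  ultimately show ?thesis
    by simp
qed

theorem injective_imp_sgn_det_derivative_eq:
  fixes h :: "real ^ 'n::finite \<Rightarrow> real ^ 'n"
  assumes V: "open V" "convex V" "continuous_on V h" "inj_on h V"
    and a: "a \<in> V" "(h has_derivative A) (at a)" "det (matrix A) \<noteq> 0"
    and b: "b \<in> V" "(h has_derivative B) (at b)" "det (matrix B) \<noteq> 0"
  shows "sgn (det (matrix A)) = sgn (det (matrix B))"
proof -
  obtain r1 r2 where "r1 > 0" "cball a r1 \<subseteq> V" "r2 > 0" "cball b r2 \<subseteq> V"
    using V(1) a(1) b(1) open_contains_cball by metis
  then obtain r where r: "r > 0" "cball a r \<subseteq> V" "cball b r \<subseteq> V"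
    using that[of "min r1 r2"] by (auto simp: subset_iff)
  define p where "p t = (1 - t) *\<^sub>R a + t *\<^sub>R b" for t :: real
  define H where "H t u = h (p t + r *\<^sub>R u) - h (p t)" for t u
  have p: "p t \<in> V" if "t \<in> {0..1}" for t
    unfolding p_def using that V(2) a(1) b(1) by (intro convexD) auto
  \<comment> \<open>The sphere of radius \<open>r\<close> about \<open>p t\<close> consists of
    convex combinations of corresponding points of the spheres about \<open>a\<close> and
    \<open>b\<close>, so one radius serves along the whole segment.\<close>
  have pu: "p t + r *\<^sub>R u \<in> V" if t: "t \<in> {0..1}" and u: "norm u = 1" for t u
  proof -
    have "a + r *\<^sub>R u \<in> V" "b + r *\<^sub>R u \<in> V"
      using r u by (auto simp: subset_iff dist_norm)
    then have "(1 - t) *\<^sub>R (a + r *\<^sub>R u) + t *\<^sub>R (b + r *\<^sub>R u) \<in> V"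
      using t V(2) by (intro convexD) auto
    then show ?thesis
      by (simp add: p_def algebra_simps)
  qed
  have "H t u \<noteq> 0" if "t \<in> {0..1}" "norm u = 1" for t u
  proof -
    have "p t + r *\<^sub>R u \<noteq> p t"
      using r that by auto
    then show ?thesis
      using p pu that V(4) by (auto simp: H_def dest: inj_onD)
  qed
  moreover have "continuous_on ({0..1} \<times> sphere 0 1) (\<lambda>(t, u). H t u)"
    unfolding H_def case_prod_unfold using p pu
    by (intro continuous_intros continuous_on_compose2[OF V(3)]) (auto simp: p_def intro!: continuous_intros)
  ultimately have "sphere_degree (H 0) = sphere_degree (H 1)"
    by (intro sphere_degree_homotopy) auto
  moreover have "sphere_degree (H 0) = sphere_degree A" "sphere_degree (H 1) = sphere_degree B"
    using sphere_degree_derivative[OF V(1,3,4) r(1,2) a(2,3)] sphere_degree_derivative[OF V(1,3,4) r(1,3) b(2,3)]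
    by (simp_all add: H_def[abs_def] p_def)
  moreover have "linear A" "linear B"
    using a(2) b(2) has_derivative_linear by blast+
  ultimately show ?thesis
    using sphere_degree_linear a(3) b(3) by metis
qed

section \<open>Sign change of a determinant\<close>

lemma tendsto_det:
  fixes A :: "'b \<Rightarrow> real ^ 'n::finite ^ 'n"
  assumes "\<And>i j. ((\<lambda>t. A t $ i $ j) \<longlongrightarrow> A0 $ i $ j) F"
  shows "((\<lambda>t. det (A t)) \<longlongrightarrow> det A0) F"
  unfolding det_def by (intro tendsto_intros assms)

text \<open>The derivative of a family of matrices is given only vector by vector, so linearity of
  its limits has to be recovered from pointwise convergence.\<close>

lemma tendsto_pointwise_linear:
  fixes A :: "'b \<Rightarrow> real ^ 'n::finite ^ 'n"
  assumes "\<And>w. ((\<lambda>t. A t *v w) \<longlongrightarrow> g w) F" and "F \<noteq> bot"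
  shows "linear g"
proof (rule linearI)
  fix u v and c :: real
  have "((\<lambda>t. A t *v u + A t *v v) \<longlongrightarrow> g u + g v) F" "((\<lambda>t. c *\<^sub>R (A t *v u)) \<longlongrightarrow> c *\<^sub>R g u) F"
    by (intro tendsto_intros assms(1))+
  moreover have "((\<lambda>t. A t *v u + A t *v v) \<longlongrightarrow> g (u + v)) F" "((\<lambda>t. c *\<^sub>R (A t *v u)) \<longlongrightarrow> g (c *\<^sub>R u)) F"
    using assms(1)[of "u + v"] assms(1)[of "c *\<^sub>R u"]
    by (simp_all add: matrix_vector_right_distrib matrix_vector_mult_scaleR)
  ultimately show "g (u + v) = g u + g v" "g (c *\<^sub>R u) = c *\<^sub>R g u"
    using tendsto_unique[OF assms(2)] by blast+
qed

lemma tendsto_det_matrix: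
  fixes T :: "'b \<Rightarrow> real ^ 'n::finite \<Rightarrow> real ^ 'n"
  assumes "\<And>w. ((\<lambda>t. T t w) \<longlongrightarrow> g w) F"
  shows "((\<lambda>t. det (matrix (T t))) \<longlongrightarrow> det (matrix g)) F"
  by (rule tendsto_det) (simp add: matrix_def tendsto_vec_nth assms)

text \<open>For orthonormal \<open>B\<close> this is multiplication by \<open>t\<close> on
  \<open>span B\<close> and the identity on the orthogonal complement.\<close>

definition stretch :: "'v::real_inner set \<Rightarrow> real \<Rightarrow> 'v \<Rightarrow> 'v" where
  "stretch B t x = x + (t - 1) *\<^sub>R (\<Sum>b\<in>B. (b \<bullet> x) *\<^sub>R b)"

lemma linear_stretch: "linear (stretch B t)"
  by (rule linearI)
    (simp_all add: stretch_def inner_add_right algebra_simps sum.distrib scaleR_sum_right sum_distrib_left)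

text \<open>An orthogonal map carrying a coordinate axis to \<open>c\<close> conjugates this stretch
  to a diagonal matrix with a single entry \<open>t\<close> and all others 1.\<close>

lemma det_stretch_unit:
  fixes c :: "real ^ 'n::finite"
  assumes "norm c = 1"
  shows "det (matrix (stretch {c} t)) = t"
proof -
  obtain k :: 'n where True by simp
  let ?e = "axis k 1 :: real ^ 'n"
  obtain f where f: "orthogonal_transformation f" "f ?e = c"
    using orthogonal_transformation_exists_1[of ?e c] assms by auto
  have lin: "linear f" and inner: "f x \<bullet> f y = x \<bullet> y" for x y
    using f(1) by (auto simp: orthogonal_transformation_def)
  have "stretch {c} t \<circ> f = f \<circ> stretch {?e} t"
    using f(2) inner[of ?e] by (auto simp: fun_eq_iff stretch_def linear_add[OF lin] linear_cmul[OF lin])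
  then have "matrix (stretch {c} t) ** matrix f = matrix f ** matrix (stretch {?e} t)"
    by (metis matrix_compose lin linear_stretch)
  then have "det (matrix (stretch {c} t)) * det (matrix f) = det (matrix f) * det (matrix (stretch {?e} t))"
    by (metis det_mul)
  moreover have "det (matrix f) \<noteq> 0"
    using f(1) lin orthogonal_transformation_inj det_nz_iff_inj by blast
  moreover have "det (matrix (stretch {?e} t)) = t"
  proof -
    have s: "stretch {?e} t x $ i = (if i = k then t * x $ i else x $ i)" for x i
    proof -
      have "stretch {?e} t x = x + (t - 1) *\<^sub>R (x $ k *\<^sub>R ?e)"
        by (simp add: stretch_def inner_axis')
      then show ?thesis
        by (simp add: axis_def left_diff_distrib)
    qed
    have "det (matrix (stretch {?e} t)) = (\<Prod>i\<in>UNIV. matrix (stretch {?e} t) $ i $ i)"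
      by (rule det_diagonal) (simp add: matrix_def s, simp add: axis_def)
    also have "\<dots> = (\<Prod>i\<in>UNIV. if i = k then t else 1)"
      by (intro prod.cong) (simp_all add: matrix_def s)
    finally show ?thesis by simp
  qed
  ultimately show ?thesis by simp
qed

text \<open>Since \<open>c\<close> is orthogonal to \<open>B\<close>, stretching along
  \<open>B\<close> does not change the component along \<open>c\<close>. The stretch is thus a
  composition of one-dimensional ones, each contributing a factor \<open>t\<close>.\<close>

lemma det_stretch:
  fixes B :: "(real ^ 'n::finite) set"
  assumes "finite B" "pairwise orthogonal B" "\<And>b. b \<in> B \<Longrightarrow> norm b = 1"
  shows "det (matrix (stretch B t)) = t ^ card B"
  using assms
proof (induction B rule: finite_induct)
  case empty
  then show ?case
    by (simp add: stretch_def[abs_def] matrix_id_mat_1[unfolded id_def])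
next
  case (insert c B)
  have orth: "c \<bullet> b = 0" if "b \<in> B" for b
    using insert that by (auto simp: pairwise_insert orthogonal_def)
  have "c \<bullet> stretch B t x = c \<bullet> x" for x
    using orth by (simp add: stretch_def inner_add_right inner_sum_right)
  moreover have "stretch {c} t y = y + (t - 1) *\<^sub>R ((c \<bullet> y) *\<^sub>R c)" for y
    by (simp add: stretch_def)
  moreover have "stretch (insert c B) t x = stretch B t x + (t - 1) *\<^sub>R ((c \<bullet> x) *\<^sub>R c)" for x
    unfolding stretch_def sum.insert[OF insert.hyps] scaleR_add_right by (simp only: ac_simps)
  ultimately have "stretch {c} t (stretch B t x) = stretch (insert c B) t x" for x
    by simp
  then have "stretch (insert c B) t = stretch {c} t \<circ> stretch B t"
    by (simp add: fun_eq_iff)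
  then show ?case
    using insert by (simp add: matrix_compose linear_stretch det_mul det_stretch_unit pairwise_insert del: o_apply comp_apply)
qed

text \<open>The matrix \<open>C t\<close> in the proof is \<open>A t\<close> multiplied by \<open>1 / t\<close> on the kernel of \<open>A 0\<close>.\<close>

lemma det_opposite_signs:
  fixes A :: "real \<Rightarrow> real ^ 'n::finite ^ 'n"
  assumes deriv: "\<And>w. ((\<lambda>t. A t *v w) has_vector_derivative d w) (at 0)"
    and odd: "odd (dim {w. A 0 *v w = 0})"
    and inj: "\<And>w. A 0 *v w = 0 \<Longrightarrow> d w \<in> range ((*v) (A 0)) \<Longrightarrow> w = 0"
  shows "\<forall>\<^sub>F t in at_right 0. det (A t) * det (A (- t)) < 0"
proof -
  define K where "K = {w. A 0 *v w = 0}"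
  have "subspace K"
    by (auto simp: K_def subspace_def matrix_vector_right_distrib matrix_vector_mult_scaleR)
  then obtain B where B: "B \<subseteq> K" "pairwise orthogonal B" "\<And>b. b \<in> B \<Longrightarrow> norm b = 1"
    "independent B" "card B = dim K" "span B = K"
    using orthonormal_basis_subspace by metis
  have fin: "finite B"
    using B(4) independent_imp_finite by blast
  define P where "P w = (\<Sum>b\<in>B. (b \<bullet> w) *\<^sub>R b)" for w
  have PK: "P w \<in> K" for w
    unfolding P_def B(6)[symmetric] by (intro span_sum span_scale span_base)
  have P_id: "P w = w" if "w \<in> K" for w
  proof -
    have orth: "b \<bullet> (w - P w) = 0" if "b \<in> B" for b
    proof -
      have "b \<bullet> P w = (\<Sum>c\<in>B. if c = b then b \<bullet> w else 0)"
        unfolding P_def inner_sum_right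
        using B(2,3) that by (intro sum.cong)
          (auto simp: pairwise_def orthogonal_def norm_eq_1)
      then show ?thesis
        using that fin by (simp add: inner_diff_right)
    qed
    have "w - P w \<in> span B"
      using that PK B(6) \<open>subspace K\<close> by (auto intro: subspace_diff)
    then have "orthogonal (w - P w) (w - P w)"
      by (rule orthogonal_to_span) (use orth in \<open>simp add: orthogonal_def inner_commute\<close>)
    then show ?thesis
      by (simp add: orthogonal_def)
  qed
  define C where "C t = A t ** matrix (stretch B (1 / t))" for t
  have C: "C t *v w = A t *v (w - P w) + (1 / t) *\<^sub>R (A t *v P w)" for t w
    by (simp add: C_def matrix_vector_mul_assoc[symmetric] matrix_works linear_stretch
        stretch_def P_def matrix_vector_right_distrib matrix_vector_mult_diff_distrib
        matrix_vector_mult_scaleR algebra_simps)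
  \<comment> \<open>As \<open>P w\<close> lies in the kernel of \<open>A 0\<close>, the term with
    \<open>1 / t\<close> is a difference quotient at 0, with limit \<open>d (P w)\<close>. In the
    other term continuity suffices, and \<open>A 0\<close> does not see \<open>P w\<close>.\<close>
  have lim: "((\<lambda>t. C t *v w) \<longlongrightarrow> A 0 *v w + d (P w)) (at 0)" for w
  proof -
    have "isCont (\<lambda>t. A t *v (w - P w)) 0"
      using deriv has_vector_derivative_continuous by blast
    then have "((\<lambda>t. A t *v (w - P w)) \<longlongrightarrow> A 0 *v w) (at 0)"
      using PK[of w] by (simp add: isCont_def matrix_vector_mult_diff_distrib K_def)
    moreover have "((\<lambda>t. (1 / t) *\<^sub>R (A t *v P w)) \<longlongrightarrow> d (P w)) (at 0)"
    proof -
      have "(\<lambda>h. norm (A h *v P w - h *\<^sub>R d (P w)) / norm h) \<midarrow>0\<rightarrow> 0"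
        using deriv[of "P w"] PK[of w] by (simp add: has_vector_derivative_def has_derivative_at K_def)
      moreover have "norm (A h *v P w - h *\<^sub>R d (P w)) / norm h = norm ((1 / h) *\<^sub>R (A h *v P w) - d (P w))"
        if "h \<noteq> 0" for h
      proof -
        have "(1 / h) *\<^sub>R (A h *v P w) - d (P w) = (1 / h) *\<^sub>R (A h *v P w - h *\<^sub>R d (P w))"
          using that by (simp add: scaleR_diff_right)
        then show ?thesis
          using that by (simp add: divide_inverse mult.commute)
      qed
      ultimately have "(\<lambda>h. norm ((1 / h) *\<^sub>R (A h *v P w) - d (P w))) \<midarrow>0\<rightarrow> 0"
        by (subst (asm) LIM_cong[OF refl _ refl]) auto
      then show ?thesis
        by (blast intro: LIM_zero_cancel tendsto_norm_zero_cancel)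
    qed
    ultimately show ?thesis
      unfolding C by (rule tendsto_add)
  qed
  define g where "g w = A 0 *v w + d (P w)" for w
  have lin: "linear g"
    using lim unfolding g_def by (rule tendsto_pointwise_linear) simp
  \<comment> \<open>If \<open>g w = 0\<close>, then \<open>d (P w)\<close> lies in the range of
    \<open>A 0\<close>, so \<open>P w = 0\<close> by hypothesis. What remains is
    \<open>A 0 *v w = 0\<close>, hence \<open>w\<close> is in the kernel and equals
    \<open>P w\<close>.\<close>
  have "w = 0" if "g w = 0" for w
  proof -
    have "d (P w) = A 0 *v (- w)"
      using that linear_neg[OF matrix_vector_mul_linear, of "A 0" w] by (simp add: g_def add_eq_0_iff)
    then have "P w = 0"
      using inj PK unfolding K_def by blast
    moreover have "d 0 = 0"
      using deriv[of 0] vector_derivative_unique_at[OF _ has_vector_derivative_const] by fastforce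
    ultimately have "w \<in> K"
      using that by (simp add: g_def K_def)
    then show ?thesis
      using P_id \<open>P w = 0\<close> by simp
  qed
  then have nz: "det (matrix g) \<noteq> 0"
    using det_nz_iff_inj[OF lin] linear_injective_0[OF lin] by blast
  have "((\<lambda>t. det (C t)) \<longlongrightarrow> det (matrix g)) (at 0)"
    using tendsto_det_matrix[of "\<lambda>t. (*v) (C t)", OF lim] by (simp add: g_def[abs_def])
  then have *: "((\<lambda>t. det (C t)) \<longlongrightarrow> det (matrix g)) (at_right 0)" "((\<lambda>t. det (C t)) \<longlongrightarrow> det (matrix g)) (at_left 0)"
    by (auto simp: filterlim_at_split)
  then have "((\<lambda>t. det (C t) * det (C (- t))) \<longlongrightarrow> det (matrix g) * det (matrix g)) (at_right 0)"
    by (intro tendsto_mult) (auto simp: filterlim_at_left_to_right)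
  then have "\<forall>\<^sub>F t in at_right 0. det (C t) * det (C (- t)) > 0"
    by (rule order_tendstoD(1)) (use nz in \<open>auto simp: zero_less_mult_iff\<close>)
  then show ?thesis
  proof (rule eventually_elim2[OF _ eventually_at_right_less])
    fix t :: real assume t: "det (C t) * det (C (- t)) > 0" "0 < t"
    have det: "det (C t) = det (A t) * (1 / t) ^ card B" for t
      unfolding C_def det_mul using det_stretch[OF fin B(2,3)] by simp
    have "odd (card B)"
      using odd B(5) by (simp add: K_def)
    then have "det (C t) * det (C (- t)) = - (det (A t) * det (A (- t)) * ((1 / t) ^ card B * (1 / t) ^ card B))"
      by (simp add: det power_divide)
    moreover have "(1 / t) ^ card B * (1 / t) ^ card B > 0"
      using t by simp
    ultimately show "det (A t) * det (A (- t)) < 0"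
      using t(1) by (simp add: mult_less_0_iff zero_less_mult_iff)
  qed
qed

section \<open>Existence of regular points\<close>

text \<open>The theorem \<open>baby_Sard\<close> requires well-ordered index types.\<close>

typedef (overloaded) 'n ordered_index = "{..<CARD('n::finite)}"
  by (rule exI[of _ 0]) simp

instantiation ordered_index :: (finite) "{finite, wellorder}"
begin

definition less_eq_ordered_index :: "'a ordered_index \<Rightarrow> 'a ordered_index \<Rightarrow> bool" where
  "i \<le> j \<longleftrightarrow> Rep_ordered_index i \<le> Rep_ordered_index j"

definition less_ordered_index :: "'a ordered_index \<Rightarrow> 'a ordered_index \<Rightarrow> bool" where
  "i < j \<longleftrightarrow> Rep_ordered_index i < Rep_ordered_index j"

instance
proof
  show "finite (UNIV :: 'a ordered_index set)"
    using type_definition.univ[OF type_definition_ordered_index] by (metis finite_imageI finite_lessThan)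
  fix P and a :: "'a ordered_index"
  assume step: "\<And>x :: 'a ordered_index. (\<And>y. y < x \<Longrightarrow> P y) \<Longrightarrow> P x"
  show "P a"
  proof (induction "Rep_ordered_index a" arbitrary: a rule: less_induct)
    case less
    show ?case
      by (rule step, rule less) (simp add: less_ordered_index_def)
  qed
qed (auto simp: less_eq_ordered_index_def less_ordered_index_def Rep_ordered_index_inject)

end

lemma card_ordered_index [simp]: "CARD('n::finite ordered_index) = CARD('n)"
  using type_definition.card[OF type_definition_ordered_index] by simp

text \<open>If all derivatives on \<open>V\<close> were singular, Sard's theorem would make the
  image negligible, which a nonempty open set is not.\<close>

lemma exists_nonsingular_derivative:
  fixes h :: "real ^ 'n::finite \<Rightarrow> real ^ 'n"
  assumes V: "V \<noteq> {}" "open (h ` V)"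
    and D: "\<And>x. x \<in> V \<Longrightarrow> (h has_derivative D x) (at x)"
  shows "\<exists>x\<in>V. det (matrix (D x)) \<noteq> 0"
proof (rule ccontr)
  assume "\<not> (\<exists>x\<in>V. det (matrix (D x)) \<noteq> 0)"
  then have sing: "\<not> inj (D x)" if "x \<in> V" for x
    using that D det_nz_iff_inj has_derivative_linear by blast
  \<comment> \<open>\<open>P\<close> and \<open>Q\<close> merely relabel the coordinates by a
    well-ordered index type; openness and singularity are unaffected.\<close>
  obtain \<sigma> :: "'n ordered_index \<Rightarrow> 'n" where \<sigma>: "bij \<sigma>"
    using finite_same_card_bij[of "UNIV :: 'n ordered_index set" "UNIV :: 'n set"] by auto
  define P :: "real ^ 'n \<Rightarrow> real ^ 'n ordered_index" where "P x = (\<chi> i. x $ \<sigma> i)" for x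
  define Q :: "real ^ 'n ordered_index \<Rightarrow> real ^ 'n" where "Q y = (\<chi> j. y $ inv_into UNIV \<sigma> j)" for y
  have PQ [simp]: "P (Q y) = y" "Q (P x) = x" for x y
    using \<sigma> by (simp_all add: P_def Q_def vec_eq_iff bij_is_inj bij_is_surj surj_f_inv_f)
  have lin: "linear P" "linear Q"
    by (auto simp: linear_iff P_def Q_def vec_eq_iff)
  then have bl: "bounded_linear P" "bounded_linear Q"
    by (simp_all add: linear_conv_bounded_linear)
  define V' where "V' = P ` V"
  have "negligible ((P \<circ> h \<circ> Q) ` V')"
  proof (rule baby_Sard)
    fix y assume y: "y \<in> V'"
    then have Qy: "Q y \<in> V"
      by (auto simp: V'_def)
    have "(P \<circ> h \<circ> Q has_derivative P \<circ> D (Q y) \<circ> Q) (at y)"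
      by (intro diff_chain_at bounded_linear_imp_has_derivative bl D Qy)
    then show "(P \<circ> h \<circ> Q has_derivative P \<circ> D (Q y) \<circ> Q) (at y within V')"
      by (rule has_derivative_at_withinI)
    have "linear (P \<circ> D (Q y) \<circ> Q)"
      using lin has_derivative_linear[OF D[OF Qy]] by (intro linear_compose)
    moreover have "\<not> inj (P \<circ> D (Q y) \<circ> Q)"
    proof
      assume *: "inj (P \<circ> D (Q y) \<circ> Q)"
      have "inj (D (Q y))"
      proof (rule injI)
        fix u v assume "D (Q y) u = D (Q y) v"
        then have "(P \<circ> D (Q y) \<circ> Q) (P u) = (P \<circ> D (Q y) \<circ> Q) (P v)"
          by simp
        then have "P u = P v"
          by (rule injD[OF *])
        then show "u = v"
          by (metis PQ(2))
      qed
      then show False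
        using sing[OF Qy] by simp
    qed
    moreover have "(*v) (matrix (P \<circ> D (Q y) \<circ> Q)) = P \<circ> D (Q y) \<circ> Q"
      using matrix_vector_mul(2)[OF \<open>linear (P \<circ> D (Q y) \<circ> Q)\<close>] .
    ultimately show "rank (matrix (P \<circ> D (Q y) \<circ> Q)) < CARD('n ordered_index)"
      unfolding less_rank_noninjective by (simp only: not_False_eq_True)
  qed simp
  moreover have "(P \<circ> h \<circ> Q) ` V' = Q -` (h ` V)"
  proof -
    have "y \<in> P ` X \<longleftrightarrow> Q y \<in> X" for y X
      using PQ by (metis imageE image_eqI)
    then have "P ` X = Q -` X" for X
      by blast
    moreover have "(P \<circ> h \<circ> Q) ` V' = P ` (h ` V)"
      by (simp add: V'_def image_comp o_def)
    ultimately show ?thesis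
      by simp
  qed
  moreover have "open (Q -` (h ` V))"
    using V(2) lin(2) by (simp add: continuous_open_vimage linear_continuous_at linear_conv_bounded_linear)
  moreover have "Q -` (h ` V) \<noteq> {}"
    using V(1) by (metis PQ(2) all_not_in_conv image_is_empty vimage_eq)
  ultimately show False
    using open_not_negligible by metis
qed

section \<open>Continuity of smooth maps and of their derivatives; local injectivity\<close>

lemma isCont_iff_tendsto_nhds: "isCont f a \<longleftrightarrow> (f \<longlongrightarrow> f a) (nhds a)"
  by (simp only: isCont_def tendsto_at_iff_tendsto_nhds[of f])

lemma smooth_on_has_derivative:
  assumes "smooth_on S h" "x \<in> S"
  shows "(h has_derivative frechet_derivative h (at x)) (at x)"
  using smooth_on_differentiable[OF assms] frechet_derivative_works by blast

lemma smooth_on_isCont: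
  assumes "smooth_on S h" "x \<in> S"
  shows "isCont h x"
  using smooth_on_has_derivative[OF assms] has_derivative_continuous by blast

lemma smooth_on_isCont_derivative:
  assumes "smooth_on S h" "x \<in> S"
  shows "isCont (\<lambda>x. frechet_derivative h (at x) v) x"
proof -
  have "Ck_on (Suc (Suc 0)) S h"
    using assms(1) unfolding smooth_on_def by blast
  then have "(\<lambda>x. frechet_derivative h (at x) v) differentiable (at x)"
    using assms(2) by simp
  then show ?thesis
    by (rule differentiable_imp_continuous_within)
qed

text \<open>Only the injectivity part of the inverse function theorem is extracted; openness is
  later supplied by invariance of domain.\<close>

lemma smooth_on_locally_injective:
  fixes h :: "real ^ 'n::finite \<Rightarrow> real ^ 'n"
  assumes S: "open S" "smooth_on S h" and a: "a \<in> S"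
    and det: "det (matrix (frechet_derivative h (at a))) \<noteq> 0"
  obtains r where "r > 0" "ball a r \<subseteq> S" "inj_on h (ball a r)"
proof -
  let ?D = "\<lambda>x. frechet_derivative h (at x)"
  have lin: "linear (?D x)" if "x \<in> S" for x
    using smooth_on_has_derivative[OF S(2) that] has_derivative_linear by blast
  obtain g where g: "linear g" "g \<circ> ?D a = id"
    using det det_nz_iff_inj[OF lin[OF a]] linear_injective_left_inverse[OF lin[OF a]] by blast
  \<comment> \<open>Smoothness gives continuity of the derivative only at fixed vectors. Summing
    over the finite basis bounds the operator norm of the difference.\<close>
  have small: "\<exists>d>0. \<forall>x. dist a x < d \<longrightarrow> onorm (\<lambda>v. ?D x v - ?D a v) < e" if "e > 0" for e
  proof -
    have "isCont (\<lambda>x. \<Sum>b\<in>Basis. norm (?D x b - ?D a b)) a"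
      by (intro continuous_intros smooth_on_isCont_derivative[OF S(2) a])
    then have "((\<lambda>x. \<Sum>b\<in>Basis. norm (?D x b - ?D a b)) \<longlongrightarrow> (\<Sum>b\<in>Basis. norm (?D a b - ?D a b))) (nhds a)"
      by (simp only: isCont_def tendsto_at_iff_tendsto_nhds[of "\<lambda>x. \<Sum>b\<in>Basis. norm (?D x b - ?D a b)"])
    then have "\<forall>\<^sub>F x in nhds a. (\<Sum>b\<in>Basis. norm (?D x b - ?D a b)) < e"
      using that by (auto dest: order_tendstoD)
    moreover have "\<forall>\<^sub>F x in nhds a. x \<in> S"
      using S(1) a by (rule eventually_nhds_in_open)
    ultimately have "\<forall>\<^sub>F x in nhds a. onorm (\<lambda>v. ?D x v - ?D a v) < e"
    proof eventually_elim
      case (elim x)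
      have "bounded_linear (\<lambda>v. ?D x v - ?D a v)"
        using lin[OF elim(2)] lin[OF a] by (intro bounded_linear_sub) (simp_all add: linear_conv_bounded_linear)
      from onorm_componentwise[OF this] elim(1) show ?case
        by linarith
    qed
    then show ?thesis
      by (auto simp: eventually_nhds_metric dist_commute)
  qed
  show thesis
    by (rule has_derivative_locally_injective[where f' = ?D and g' = g and f = h, OF a S(1) _ g(2)])
      (use g(1) small that smooth_on_has_derivative[OF S(2)] in \<open>simp_all add: linear_conv_bounded_linear\<close>)
qed

section \<open>Jacobian determinants in charts\<close>

text \<open>With \<open>h = snd c'\<close> this is the Jacobian determinant of the coordinate change
  from \<open>c\<close> to \<open>c'\<close>, so one notion covers the map and the
  transitions.\<close>

definition chart_det :: "('a \<Rightarrow> real ^ 'n::finite) \<Rightarrow> ('a, 'n) chart \<Rightarrow> 'a \<Rightarrow> real" where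
  "chart_det h c y = det (matrix (frechet_derivative (h \<circ> chart_inv c) (at (snd c y))))"

lemma det_matrix_compose:
  fixes f g :: "real ^ 'n::finite \<Rightarrow> real ^ 'n"
  assumes "linear f" "linear g"
  shows "det (matrix (f \<circ> g)) = det (matrix f) * det (matrix g)"
  by (simp only: matrix_compose[OF assms(2,1)] det_mul)

context smooth_manifold
begin

lemma chart_inv_right [simp]: "p \<in> snd c ` fst c \<Longrightarrow> snd c (chart_inv c p) = p"
  by (rule f_inv_into_f)

lemma chart_subset: "c \<in> A \<Longrightarrow> fst c \<subseteq> topspace M"
  using openin_chart openin_subset by blast

lemma open_chart_range: "c \<in> A \<Longrightarrow> open (snd c ` fst c)"
  using charts[of "fst c" "snd c"] by simp

lemma continuous_map_chart:
  "c \<in> A \<Longrightarrow> continuous_map (subtopology M (fst c)) (top_of_set (snd c ` fst c)) (snd c)"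
  using charts[of "fst c" "snd c"] by (intro homeomorphic_imp_continuous_map) simp

lemma openin_chart_preimage:
  assumes "c \<in> A" "open S"
  shows "openin M {y \<in> fst c. snd c y \<in> S}"
proof -
  have "continuous_map (subtopology M (fst c)) euclidean (snd c)"
    using continuous_map_chart[OF assms(1)] continuous_map_into_fulltopology by blast
  then have "openin (subtopology M (fst c)) {y \<in> topspace (subtopology M (fst c)). snd c y \<in> S}"
    by (rule openin_continuous_map_preimage) (use assms in simp)
  moreover have "topspace (subtopology M (fst c)) = fst c"
    using chart_subset[OF assms(1)] by auto
  ultimately have "openin (subtopology M (fst c)) {y \<in> fst c. snd c y \<in> S}"
    by (simp only:)
  then show ?thesis
    using openin_chart[OF assms(1)] openin_trans_full by blast
qed

lemma eventually_chart_imp_neighbourhood: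
  assumes c: "c \<in> A" "x \<in> fst c"
    and ev: "\<forall>\<^sub>F p in nhds (snd c x). P (chart_inv c p)"
  obtains W where "openin M W" "x \<in> W" "W \<subseteq> fst c" "\<And>y. y \<in> W \<Longrightarrow> P y"
proof -
  obtain S where S: "open S" "snd c x \<in> S" "\<And>p. p \<in> S \<Longrightarrow> P (chart_inv c p)"
    using ev unfolding eventually_nhds by blast
  have "P y" if "y \<in> fst c" "snd c y \<in> S" for y
    using S(3)[OF that(2)] that(1) c(1) by simp
  then show thesis
    using that[OF openin_chart_preimage[OF c(1) S(1)]] S(2) c(2) by simp
qed

lemma linear_transition_derivative:
  assumes "c \<in> A" "c' \<in> A" "x \<in> fst c" "x \<in> fst c'"
  shows "linear (frechet_derivative (transition c c') (at (snd c x)))"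
  by (rule linear_frechet_derivative[OF transition_differentiable[OF assms]])

lemma reading_differentiable_change_chart:
  fixes h :: "'a \<Rightarrow> 'b::euclidean_space"
  assumes c: "c \<in> A" "c' \<in> A" "x \<in> fst c" "x \<in> fst c'"
    and h: "(h \<circ> chart_inv c') differentiable (at (snd c' x))"
  shows "(h \<circ> chart_inv c) differentiable (at (snd c x))"
proof -
  have "(h \<circ> chart_inv c') \<circ> transition c c' differentiable (at (snd c x))"
    using h c by (intro differentiable_chain_at transition_differentiable[OF c]) simp
  then obtain D where "((h \<circ> chart_inv c') \<circ> transition c c' has_derivative D) (at (snd c x))"
    unfolding differentiable_def by blast
  then have "(h \<circ> chart_inv c has_derivative D) (at (snd c x))"
    by (rule has_derivative_transform_within_open[where s = "snd c ` (fst c \<inter> fst c')"])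
      (use c in \<open>auto simp: open_chart_overlap\<close>)
  then show ?thesis
    unfolding differentiable_def by blast
qed

lemma chart_det_change_chart:
  assumes c: "c \<in> A" "c' \<in> A" "x \<in> fst c" "x \<in> fst c'"
    and h: "(h \<circ> chart_inv c') differentiable (at (snd c' x))"
  shows "chart_det h c x = chart_det h c' x * chart_det (snd c') c x"
proof -
  have "frechet_derivative (h \<circ> chart_inv c) (at (snd c x)) =
      frechet_derivative (h \<circ> chart_inv c') (at (snd c' x)) \<circ> frechet_derivative (transition c c') (at (snd c x))"
    using frechet_derivative_change_chart[OF c h] by (simp add: fun_eq_iff)
  then show ?thesis
    unfolding chart_det_def
    using det_matrix_compose[OF linear_frechet_derivative[OF h] linear_transition_derivative[OF c]]
    by simp
qed

text \<open>The chain rule is applied to \<open>snd c\<close> itself: its Jacobian in the chart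
  \<open>c\<close> is 1, and it factors through \<open>c'\<close>.\<close>

lemma chart_det_transition_nonzero:
  assumes "c \<in> A" "c' \<in> A" "x \<in> fst c" "x \<in> fst c'"
  shows "chart_det (snd c') c x \<noteq> 0"
proof -
  have "(transition c' c') differentiable (at (snd c' x))" "(transition c' c) differentiable (at (snd c' x))"
    using assms transition_differentiable by blast+
  have 1: "chart_det (snd c) c x = 1"
  proof -
    have "(snd c \<circ> chart_inv c has_derivative id) (at (snd c x))"
      by (rule has_derivative_transform_within_open[OF has_derivative_id open_chart_range[OF assms(1)]])
        (use assms in auto)
    then show ?thesis
      by (simp add: chart_det_def matrix_id_mat_1 flip: frechet_derivative_at)
  qed
  have "chart_det (snd c) c x = chart_det (snd c) c' x * chart_det (snd c') c x"
    using chart_det_change_chart[OF assms] transition_differentiable assms by metis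
  then show ?thesis
    using 1 by auto
qed

text \<open>Serves to compare, near one point, a chart of the given atlas with an oriented chart.
  Their relative orientation is unknown but locally constant, by continuity of a nonvanishing
  determinant.\<close>

lemma chart_det_transition_sign:
  assumes c: "c \<in> A" "c' \<in> A" "x \<in> fst c" "x \<in> fst c'"
  obtains W where "openin M W" "x \<in> W" "W \<subseteq> fst c" "W \<subseteq> fst c'"
    "\<forall>y\<in>W. chart_det (snd c') c y * chart_det (snd c') c x > 0"
proof -
  let ?S = "snd c ` (fst c \<inter> fst c')" and ?d = "chart_det (snd c') c x"
  define F where "F p = det (matrix (frechet_derivative (transition c c') (at p)))" for p
  have Fx: "F (snd c x) = ?d"
    by (simp add: F_def chart_det_def)
  have x: "snd c x \<in> ?S"
    using c by blast
  have "F \<midarrow>snd c x\<rightarrow> F (snd c x)"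
    unfolding F_def
    by (rule tendsto_det_matrix) (use smooth_on_isCont_derivative[OF smooth_transitions[OF c(1,2)] x] in \<open>simp only: isCont_def\<close>)
  then have "isCont (\<lambda>p. F p * ?d) (snd c x)"
    unfolding isCont_def by (rule tendsto_mult_right)
  moreover have "F (snd c x) * ?d > 0"
    unfolding Fx using chart_det_transition_nonzero[OF c] by (cases "?d > 0") (auto simp: zero_less_mult_iff)
  ultimately have "\<forall>\<^sub>F p in nhds (snd c x). F p * ?d > 0"
    unfolding isCont_iff_tendsto_nhds by (rule order_tendstoD(1))
  moreover have "\<forall>\<^sub>F p in nhds (snd c x). p \<in> ?S"
    using open_chart_overlap[OF c(1,2)] x by (rule eventually_nhds_in_open)
  ultimately have "\<forall>\<^sub>F p in nhds (snd c x). chart_inv c p \<in> fst c' \<and> chart_det (snd c') c (chart_inv c p) * ?d > 0"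
    by eventually_elim (use c in \<open>auto simp: chart_det_def F_def\<close>)
  then obtain W where "openin M W" "x \<in> W" "W \<subseteq> fst c"
    "\<And>y. y \<in> W \<Longrightarrow> y \<in> fst c' \<and> chart_det (snd c') c y * ?d > 0"
    using eventually_chart_imp_neighbourhood[OF c(1,3), of "\<lambda>y. y \<in> fst c' \<and> chart_det (snd c') c y * ?d > 0"] by blast
  then show thesis
    using that by blast
qed

end

section \<open>Local orientation away from the branch set\<close>

text \<open>The inequality is weak because the Jacobian may vanish at points that are not branch
  points. Demanding it on a neighbourhood makes the set open.\<close>

definition orientation_set ::
    "'a topology \<Rightarrow> ('a, 'n::finite) chart set \<Rightarrow> ('a \<Rightarrow> real ^ 'n) \<Rightarrow> real \<Rightarrow> 'a set" where
  "orientation_set M B h s =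
     {y. \<exists>W. openin M W \<and> y \<in> W \<and> (\<forall>z\<in>W. \<forall>c\<in>B. z \<in> fst c \<longrightarrow> 0 \<le> s * chart_det h c z)}"

lemma openin_orientation_set: "openin M (orientation_set M B h s)"
  by (subst openin_subopen) (auto simp: orientation_set_def)

text \<open>Of the readings in the oriented atlas only differentiability is demanded; it carries
  over by the chain rule from the atlas in which the map is smooth.\<close>

locale oriented_manifold_map = smooth_manifold M B for M :: "'a topology" and B :: "('a, 'n::finite) chart set" +
  fixes h :: "'a \<Rightarrow> real ^ 'n"
  assumes orient: "\<And>c c' y. c \<in> B \<Longrightarrow> c' \<in> B \<Longrightarrow> y \<in> fst c \<Longrightarrow> y \<in> fst c' \<Longrightarrow> chart_det (snd c') c y > 0"
    and diff: "\<And>c y. c \<in> B \<Longrightarrow> y \<in> fst c \<Longrightarrow> (h \<circ> chart_inv c) differentiable (at (snd c y))"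
begin

lemma chart_det_sign:
  assumes "c \<in> B" "c' \<in> B" "y \<in> fst c" "y \<in> fst c'" "0 \<le> s * chart_det h c y"
  shows "0 \<le> s * chart_det h c' y"
proof -
  have "s * chart_det h c y = (s * chart_det h c' y) * chart_det (snd c') c y"
    using chart_det_change_chart[OF assms(1-4) diff[OF assms(2,4)]] by simp
  then show ?thesis
    using assms(5) orient[OF assms(1-4)] mult_neg_pos[of "s * chart_det h c' y"] by force
qed

text \<open>Prepares both uses of a non-branch point. The ball is convex, as the comparison of
  Jacobian signs requires, and invariance of domain makes its image open, as the use of Sard's
  theorem requires.\<close>

lemma injective_ball:
  assumes y: "y \<in> topspace M - branch_set M h" and b: "b \<in> B" "y \<in> fst b" and N: "openin M N" "y \<in> N"
  obtains r where "r > 0" "ball (snd b y) r \<subseteq> snd b ` (fst b \<inter> N)"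
    "continuous_on (ball (snd b y) r) (h \<circ> chart_inv b)"
    "inj_on (h \<circ> chart_inv b) (ball (snd b y) r)" "open ((h \<circ> chart_inv b) ` ball (snd b y) r)"
    "\<forall>p\<in>ball (snd b y) r.
      (h \<circ> chart_inv b has_derivative frechet_derivative (h \<circ> chart_inv b) (at p)) (at p)"
proof -
  obtain U where U: "openin M U" "y \<in> U" "homeomorphic_map (subtopology M U) (subtopology euclidean (h ` U)) h"
    using y unfolding branch_set_def local_homeomorphism_at_def by auto
  have inj: "inj_on h U"
    using homeomorphic_imp_injective_map[OF U(3)] openin_subset[OF U(1)] by (simp add: Int_absorb1)
  have "openin M (fst b \<inter> (N \<inter> U))"
    using openin_chart[OF b(1)] N U by blast
  then have "open (snd b ` (fst b \<inter> (N \<inter> U)))"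
    by (rule open_chart_image[OF b(1)]) auto
  moreover have "snd b y \<in> snd b ` (fst b \<inter> (N \<inter> U))"
    using b N U by blast
  ultimately obtain r where r: "r > 0" "ball (snd b y) r \<subseteq> snd b ` (fst b \<inter> (N \<inter> U))"
    using open_contains_ball by metis
  have der: "\<forall>p\<in>ball (snd b y) r.
      (h \<circ> chart_inv b has_derivative frechet_derivative (h \<circ> chart_inv b) (at p)) (at p)"
  proof
    fix p assume "p \<in> ball (snd b y) r"
    then have "p \<in> snd b ` (fst b \<inter> (N \<inter> U))"
      by (rule subsetD[OF r(2)])
    then obtain z where "z \<in> fst b" "p = snd b z"
      by auto
    then show "(h \<circ> chart_inv b has_derivative frechet_derivative (h \<circ> chart_inv b) (at p)) (at p)"
      using diff[OF b(1)] frechet_derivative_works by auto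
  qed
  have cont: "continuous_on (ball (snd b y) r) (h \<circ> chart_inv b)"
    by (intro continuous_at_imp_continuous_on ballI) (rule has_derivative_continuous[OF der[rule_format]])
  have "inj_on (h \<circ> chart_inv b) (ball (snd b y) r)"
  proof (rule comp_inj_on)
    show "inj_on (chart_inv b) (ball (snd b y) r)"
      using r(2) by (intro inj_on_inv_into) auto
    have "chart_inv b ` ball (snd b y) r \<subseteq> U"
      using r(2) chart_inv_left[OF b(1)] by fastforce
    then show "inj_on h (chart_inv b ` ball (snd b y) r)"
      using inj inj_on_subset by blast
  qed
  moreover from this have "open ((h \<circ> chart_inv b) ` ball (snd b y) r)"
    by (rule invariance_of_domain[OF cont open_ball])
  moreover have "ball (snd b y) r \<subseteq> snd b ` (fst b \<inter> N)"
    using r(2) by blast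
  ultimately show thesis
    using that[OF r(1) _ cont _ _ der] by simp
qed

text \<open>On a ball where the reading of \<open>h\<close> is injective all nonzero Jacobians have
  the same sign, so one weak inequality holds throughout. Positive transitions carry it to every
  chart of \<open>B\<close>.\<close>

lemma orientation_sets_cover: "topspace M - branch_set M h \<subseteq> orientation_set M B h 1 \<union> orientation_set M B h (-1)"
proof
  fix y assume y: "y \<in> topspace M - branch_set M h"
  then obtain b where b: "b \<in> B" "y \<in> fst b"
    using covering by blast
  have "y \<in> topspace M"
    using y by blast
  then obtain r where r: "r > 0" "ball (snd b y) r \<subseteq> snd b ` (fst b \<inter> topspace M)"
    "continuous_on (ball (snd b y) r) (h \<circ> chart_inv b)"
    "inj_on (h \<circ> chart_inv b) (ball (snd b y) r)" "open ((h \<circ> chart_inv b) ` ball (snd b y) r)"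
    "\<forall>p\<in>ball (snd b y) r.
      (h \<circ> chart_inv b has_derivative frechet_derivative (h \<circ> chart_inv b) (at p)) (at p)"
    by (rule injective_ball[OF y b openin_topspace])
  define W where "W = {z \<in> fst b. snd b z \<in> ball (snd b y) r}"
  have W: "openin M W" "y \<in> W"
    unfolding W_def using openin_chart_preimage[OF b(1) open_ball] b(2) r(1) by simp_all
  have same: "sgn (chart_det h b z) = sgn (chart_det h b z')"
    if "z \<in> W" "z' \<in> W" "chart_det h b z \<noteq> 0" "chart_det h b z' \<noteq> 0" for z z'
  proof -
    have zz: "snd b z \<in> ball (snd b y) r" "snd b z' \<in> ball (snd b y) r"
      using that by (auto simp: W_def)
    show ?thesis
      using injective_imp_sgn_det_derivative_eq[OF open_ball convex_ball r(3,4) zz(1) r(6)[rule_format, OF zz(1)] _ zz(2) r(6)[rule_format, OF zz(2)]]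
        that(3,4) by (simp add: chart_det_def)
  qed
  have "\<exists>s\<in>{1, -1}. \<forall>z\<in>W. 0 \<le> s * chart_det h b z"
  proof (cases "\<exists>z\<in>W. chart_det h b z < 0")
    case True
    then obtain z where z: "z \<in> W" "chart_det h b z < 0" by blast
    have "chart_det h b z' \<le> 0" if "z' \<in> W" for z'
      using same[OF z(1) that] z(2) by (cases "chart_det h b z' > 0") (auto simp: sgn_real_def)
    then show ?thesis by simp
  next
    case False
    then show ?thesis by (simp add: not_less)
  qed
  then obtain s where s: "s = 1 \<or> s = -1" "\<And>z. z \<in> W \<Longrightarrow> 0 \<le> s * chart_det h b z"
    by blast
  have "0 \<le> s * chart_det h c z" if "z \<in> W" "c \<in> B" "z \<in> fst c" for z c
    using chart_det_sign[OF b(1) that(2) _ that(3) s(2)] that(1) by (simp add: W_def)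
  then have "y \<in> orientation_set M B h s"
    using W unfolding orientation_set_def by blast
  then show "y \<in> orientation_set M B h 1 \<union> orientation_set M B h (-1)"
    using s(1) by blast
qed

text \<open>At a common point both inequalities hold nearby and force the Jacobian to vanish on a
  whole ball, while the image of the ball is open; this contradicts
  \<open>exists_nonsingular_derivative\<close>.\<close>

lemma orientation_sets_disjoint:
  "orientation_set M B h 1 \<inter> orientation_set M B h (-1) \<inter> (topspace M - branch_set M h) = {}"
proof (rule ccontr)
  assume "\<not> ?thesis"
  then obtain y where y: "y \<in> topspace M - branch_set M h"
    and T: "y \<in> orientation_set M B h 1" "y \<in> orientation_set M B h (-1)"
    by blast
  obtain W1 where W1: "openin M W1" "y \<in> W1" "\<And>z c. z \<in> W1 \<Longrightarrow> c \<in> B \<Longrightarrow> z \<in> fst c \<Longrightarrow> 0 \<le> 1 * chart_det h c z"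
    using T(1) unfolding orientation_set_def by blast
  obtain W2 where W2: "openin M W2" "y \<in> W2" "\<And>z c. z \<in> W2 \<Longrightarrow> c \<in> B \<Longrightarrow> z \<in> fst c \<Longrightarrow> 0 \<le> -1 * chart_det h c z"
    using T(2) unfolding orientation_set_def by blast
  obtain b where b: "b \<in> B" "y \<in> fst b"
    using y covering by blast
  have N: "openin M (W1 \<inter> W2)" "y \<in> W1 \<inter> W2"
    using W1 W2 by blast+
  obtain r where r: "r > 0" "ball (snd b y) r \<subseteq> snd b ` (fst b \<inter> (W1 \<inter> W2))"
    "continuous_on (ball (snd b y) r) (h \<circ> chart_inv b)"
    "inj_on (h \<circ> chart_inv b) (ball (snd b y) r)" "open ((h \<circ> chart_inv b) ` ball (snd b y) r)"
    "\<forall>p\<in>ball (snd b y) r.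
      (h \<circ> chart_inv b has_derivative frechet_derivative (h \<circ> chart_inv b) (at p)) (at p)"
    by (rule injective_ball[OF y b N])
  have "ball (snd b y) r \<noteq> {}"
    using r(1) by simp
  then obtain p where p: "p \<in> ball (snd b y) r"
    "det (matrix (frechet_derivative (h \<circ> chart_inv b) (at p))) \<noteq> 0"
    using exists_nonsingular_derivative[OF _ r(5) r(6)[rule_format]] by blast
  obtain z where z: "z \<in> fst b" "z \<in> W1" "z \<in> W2" "p = snd b z"
    using p(1) r(2) by blast
  have "chart_det h b z = 0"
    using W1(3)[OF z(2) b(1) z(1)] W2(3)[OF z(3) b(1) z(1)] by simp
  then show False
    using p(2) by (simp add: chart_det_def z(4))
qed

lemma not_branch_point_imp_sign:
  assumes "y \<in> topspace M - branch_set M h"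
  obtains s W where "s = 1 \<or> s = (-1::real)" "openin M W" "y \<in> W"
    "\<forall>z\<in>W. \<forall>c\<in>B. z \<in> fst c \<longrightarrow> 0 \<le> s * chart_det h c z"
proof -
  obtain s where s: "s = 1 \<or> s = (-1::real)" "y \<in> orientation_set M B h s"
    using orientation_sets_cover assms by blast
  then show thesis
    using that unfolding orientation_set_def by blast
qed

text \<open>The image of a path missing the branch set would be separated by the two orientation
  sets: the strict sign at each endpoint excludes that endpoint from the set of the opposite
  sign.\<close>

theorem path_meets_branch_set:
  assumes b: "b1 \<in> B" "x1 \<in> fst b1" "b2 \<in> B" "x2 \<in> fst b2"
    and opposite: "chart_det h b1 x1 * chart_det h b2 x2 < 0"
    and g: "pathin M g" "g 0 = x1" "g 1 = x2"
  shows "g ` {0..1} \<inter> branch_set M h \<noteq> {}"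
proof
  assume disjoint: "g ` {0..1} \<inter> branch_set M h = {}"
  have conn: "connectedin M (g ` {0..1})"
    using connectedin_path_image[OF g(1)] .
  then have sub: "g ` {0..1} \<subseteq> topspace M - branch_set M h"
    using disjoint connectedin_subset_topspace by blast
  have cover: "g ` {0..1} \<subseteq> orientation_set M B h 1 \<union> orientation_set M B h (-1)"
    using sub orientation_sets_cover by blast
  have disj: "orientation_set M B h 1 \<inter> orientation_set M B h (-1) \<inter> g ` {0..1} = {}"
    using sub orientation_sets_disjoint by blast
  have x: "x1 \<in> g ` {0..1}" "x2 \<in> g ` {0..1}"
    using g(2,3) by force+
  have sign: "0 \<le> s * chart_det h c z" if "z \<in> orientation_set M B h s" "c \<in> B" "z \<in> fst c" for s c z
    using that unfolding orientation_set_def by blast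
  have "orientation_set M B h 1 \<inter> g ` {0..1} \<noteq> {} \<and> orientation_set M B h (-1) \<inter> g ` {0..1} \<noteq> {}"
  proof (cases "chart_det h b1 x1 > 0")
    case True
    then have "chart_det h b2 x2 < 0"
      using opposite by (simp add: mult_less_0_iff)
    then have "x2 \<notin> orientation_set M B h 1" "x1 \<notin> orientation_set M B h (-1)"
      using sign[OF _ b(1,2), of "-1"] sign[OF _ b(3,4), of 1] True by auto
    then show ?thesis
      using x cover by blast
  next
    case False
    then have "chart_det h b1 x1 < 0" "chart_det h b2 x2 > 0"
      using opposite by (auto simp: mult_less_0_iff)
    then have "x2 \<notin> orientation_set M B h (-1)" "x1 \<notin> orientation_set M B h 1"
      using sign[OF _ b(1,2), of 1] sign[OF _ b(3,4), of "-1"] by auto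
    then show ?thesis
      using x cover by blast
  qed
  with cover disj openin_orientation_set have "\<not> connectedin M (g ` {0..1})"
    unfolding connectedin by metis
  then show False
    using conn by contradiction
qed

end

section \<open>Tangent vectors in coordinates\<close>

text \<open>The kernel of the differential lies in a function space; evaluation at a chart carries
  its dimension over to \<open>real ^ 'n\<close>.\<close>

lemma dim_image_inj_on:
  fixes g :: "'v::real_vector \<Rightarrow> 'w::real_vector"
  assumes "linear g" "subspace S" "inj_on g S"
  shows "dim (g ` S) = dim S"
proof -
  obtain B where B: "B \<subseteq> S" "independent B" "S \<subseteq> span B" "card B = dim S"
    using basis_exists by blast
  have span: "span B = S"
    using B(1,3) assms(2) by (simp add: span_eq_iff span_subspace)
  show ?thesis
  proof (rule dim_unique)
    show "g ` B \<subseteq> g ` S"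
      using B(1) by blast
    show "g ` S \<subseteq> span (g ` B)"
      using span linear_span_image[OF assms(1)] by simp
    show "independent (g ` B)"
      using linear_independent_injective_image[OF assms(1) B(2)] assms(3) span by simp
    show "card (g ` B) = dim S"
      using B(1,4) assms(3) card_image inj_on_subset by metis
  qed
qed

lemma scaleR_fun_apply: "(r *\<^sub>R u) c = r *\<^sub>R u c"
  by (simp add: scaleR_fun_def)

lemma linear_evaluation: "linear (\<lambda>u :: 'b \<Rightarrow> 'v::real_vector. u c)"
  by (rule linearI) (simp_all add: plus_fun_apply scaleR_fun_apply)

context smooth_manifold
begin

lemma subspace_tangent_space: "subspace (tangent_space A x)"
proof (rule subspaceI)
  have lin: "linear (frechet_derivative (transition c c') (at (snd c x)))"
    if "c \<in> A" "c' \<in> A" "x \<in> fst c" "x \<in> fst c'" for c c'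
    using that by (rule linear_transition_derivative)
  show "0 \<in> tangent_space A x"
    by (auto simp: tangent_space_def zero_fun_apply linear_0[OF lin])
  show "u + v \<in> tangent_space A x" if "u \<in> tangent_space A x" "v \<in> tangent_space A x" for u v
    unfolding tangent_space_def
  proof (intro CollectI conjI ballI impI allI)
    fix c c' assume c: "c \<in> A" "c' \<in> A" "x \<in> fst c" "x \<in> fst c'"
    have "u c' = frechet_derivative (transition c c') (at (snd c x)) (u c)"
      "v c' = frechet_derivative (transition c c') (at (snd c x)) (v c)"
      using that c unfolding tangent_space_def by blast+
    then show "(u + v) c' = frechet_derivative (transition c c') (at (snd c x)) ((u + v) c)"
      by (simp add: plus_fun_apply linear_add[OF lin[OF c]])
  next
    fix c assume "\<not> (c \<in> A \<and> x \<in> fst c)"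
    then have "u c = 0" "v c = 0"
      using that unfolding tangent_space_def by blast+
    then show "(u + v) c = 0"
      by (simp add: plus_fun_apply)
  qed
  show "r *\<^sub>R u \<in> tangent_space A x" if "u \<in> tangent_space A x" for r u
    unfolding tangent_space_def
  proof (intro CollectI conjI ballI impI allI)
    fix c c' assume c: "c \<in> A" "c' \<in> A" "x \<in> fst c" "x \<in> fst c'"
    have "u c' = frechet_derivative (transition c c') (at (snd c x)) (u c)"
      using that c unfolding tangent_space_def by blast
    then show "(r *\<^sub>R u) c' = frechet_derivative (transition c c') (at (snd c x)) ((r *\<^sub>R u) c)"
      by (simp add: scaleR_fun_apply linear_cmul[OF lin[OF c]])
  next
    fix c assume "\<not> (c \<in> A \<and> x \<in> fst c)"
    then have "u c = 0"
      using that unfolding tangent_space_def by blast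
    then show "(r *\<^sub>R u) c = 0"
      by (simp add: scaleR_fun_apply)
  qed
qed

text \<open>This is the inverse that occurs in \<open>exponential_map_at\<close> and, for
  \<open>tangent_bundle\<close>, in \<open>trivialization_at\<close>.\<close>

definition tangent_vector :: "('a, 'n) chart \<Rightarrow> 'a \<Rightarrow> real ^ 'n \<Rightarrow> ('a, 'n) tangent_vec" where
  "tangent_vector c x w = the_inv_into (tangent_space A x) (\<lambda>u. u c) w"

lemma
  assumes "c \<in> A" "x \<in> fst c"
  shows tangent_vector_mem: "tangent_vector c x w \<in> tangent_space A x"
    and tangent_vector_apply [simp]: "tangent_vector c x w c = w"
    and tangent_vector_coord: "u \<in> tangent_space A x \<Longrightarrow> tangent_vector c x (u c) = u"
proof -
  have bij: "bij_betw (\<lambda>u. u c) (tangent_space A x) UNIV"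
    by (rule bij_betw_tangent_coordinates[OF assms])
  have inj: "inj_on (\<lambda>u. u c) (tangent_space A x)"
    using bij by (rule bij_betw_imp_inj_on)
  have im: "w \<in> (\<lambda>u. u c) ` tangent_space A x" for w
    using bij by (simp add: bij_betw_imp_surj_on)
  show "tangent_vector c x w \<in> tangent_space A x"
    unfolding tangent_vector_def by (rule the_inv_into_into[OF inj im subset_refl])
  show "tangent_vector c x w c = w"
    unfolding tangent_vector_def by (rule f_the_inv_into_f[OF inj im])
  show "tangent_vector c x (u c) = u" if "u \<in> tangent_space A x"
    unfolding tangent_vector_def using inj that by (rule the_inv_into_f_f)
qed

lemma tangent_vector_eqI:
  assumes "c \<in> A" "x \<in> fst c" "u \<in> tangent_space A x" "v \<in> tangent_space A x" "u c = v c"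
  shows "u = v"
  using tangent_vector_coord[OF assms(1,2)] assms(3-5) by metis

section \<open>Regular points and branch points\<close>

lemma smooth_on_reading:
  assumes "smooth_map_on A (topspace M) f" "c \<in> A"
  shows "smooth_on (snd c ` fst c) (f \<circ> chart_inv c)"
proof -
  have "fst c \<inter> topspace M = fst c"
    using chart_subset[OF assms(2)] by blast
  then show ?thesis
    using assms unfolding smooth_map_on_def by metis
qed

lemma regular_pointI:
  fixes f :: "'a \<Rightarrow> real ^ 'n"
  assumes f: "smooth_map_on A (topspace M) f" and c: "c \<in> A" "x \<in> fst c" and det: "chart_det f c x \<noteq> 0"
  shows "regular_point M A f x"
proof -
  let ?J = "frechet_derivative (f \<circ> chart_inv c) (at (snd c x))"
  have lin: "linear ?J"
    using smooth_on_differentiable[OF smooth_on_reading[OF f c(1)]] c(2) linear_frechet_derivative by blast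
  have "inj ?J"
    using det det_nz_iff_inj[OF lin] by (simp add: chart_det_def)
  then have "bij ?J"
    using lin linear_injective_imp_surjective by (auto simp: bij_def)
  then have "bij_betw (?J \<circ> (\<lambda>u. u c)) (tangent_space A x) UNIV"
    by (rule bij_betw_trans[OF bij_betw_tangent_coordinates[OF c]])
  then have bij: "bij_betw (differential A f x) (tangent_space A x) UNIV"
    by (subst bij_betw_cong[where g = "?J \<circ> (\<lambda>u. u c)"]) (simp_all add: differential_eq[OF f c])
  have "differential A f x (u + v) = differential A f x u + differential A f x v"
    if "u \<in> tangent_space A x" "v \<in> tangent_space A x" for u v
    using that subspace_add[OF subspace_tangent_space]
    by (simp add: differential_eq[OF f c] plus_fun_apply linear_add[OF lin])
  moreover have "differential A f x (r *\<^sub>R u) = r *\<^sub>R differential A f x u"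
    if "u \<in> tangent_space A x" for u r
    using that subspace_scale[OF subspace_tangent_space]
    by (simp add: differential_eq[OF f c] scaleR_fun_apply linear_cmul[OF lin])
  ultimately show ?thesis
    using bij c covering by (auto simp: regular_point_def linear_iso_on_def)
qed

text \<open>The reading of \<open>f\<close> is injective on a small ball, and invariance of domain
  makes it open there; a continuous open injection is a homeomorphism onto its image.\<close>

lemma nonsingular_imp_not_branch_point:
  fixes f :: "'a \<Rightarrow> real ^ 'n"
  assumes f: "smooth_map_on A (topspace M) f" and c: "c \<in> A" "x \<in> fst c" and det: "chart_det f c x \<noteq> 0"
  shows "x \<in> topspace M - branch_set M f"
proof -
  let ?h = "f \<circ> chart_inv c"
  have sm: "smooth_on (snd c ` fst c) ?h"
    by (rule smooth_on_reading[OF f c(1)])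
  have cx: "snd c x \<in> snd c ` fst c"
    using c(2) by blast
  obtain r where r: "r > 0" "ball (snd c x) r \<subseteq> snd c ` fst c" "inj_on ?h (ball (snd c x) r)"
    using smooth_on_locally_injective[OF open_chart_range[OF c(1)] sm cx] det unfolding chart_det_def by metis
  have cont: "continuous_on (ball (snd c x) r) ?h"
    using r(2) smooth_on_isCont[OF sm] by (intro continuous_at_imp_continuous_on) auto
  define U where "U = {y \<in> fst c. snd c y \<in> ball (snd c x) r}"
  have U: "openin M U" "x \<in> U" "U \<subseteq> fst c"
    unfolding U_def using openin_chart_preimage[OF c(1) open_ball] c(2) r(1) by auto
  have top: "topspace (subtopology M U) = U"
    using openin_subset[OF U(1)] by auto
  have f_eq: "f y = ?h (snd c y)" if "y \<in> fst c" for y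
    using that c(1) by simp
  have image_open: "open (f ` Q)" if "openin M Q" "Q \<subseteq> U" for Q
  proof -
    have sub: "snd c ` Q \<subseteq> ball (snd c x) r"
      using that(2) by (auto simp: U_def)
    have "open (snd c ` Q)"
      using that(2) U(3) by (intro open_chart_image[OF c(1) that(1)]) auto
    from invariance_of_domain[OF continuous_on_subset[OF cont sub] this inj_on_subset[OF r(3) sub]]
    have "open (?h ` snd c ` Q)" .
    moreover have "f ` Q = ?h ` snd c ` Q"
      unfolding image_image using that(2) U(3) by (intro image_cong[OF refl f_eq]) blast
    ultimately show ?thesis by simp
  qed
  have "homeomorphic_map (subtopology M U) (subtopology euclidean (f ` U)) f"
  proof (rule bijective_open_imp_homeomorphic_map)
    have "continuous_map (subtopology M U) (top_of_set (snd c ` fst c)) (snd c)"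
      using continuous_map_from_subtopology_mono[OF continuous_map_chart[OF c(1)] U(3)] .
    then have "continuous_map (subtopology M U) (top_of_set (ball (snd c x) r)) (snd c)"
      using top by (auto simp: continuous_map_in_subtopology U_def)
    moreover have "continuous_map (top_of_set (ball (snd c x) r)) euclidean ?h"
      using cont by simp
    ultimately have "continuous_map (subtopology M U) euclidean (?h \<circ> snd c)"
      by (rule continuous_map_compose)
    then have "continuous_map (subtopology M U) euclidean f"
      by (rule continuous_map_eq) (use f_eq U(3) top in auto)
    then show "continuous_map (subtopology M U) (subtopology euclidean (f ` U)) f"
      using top by (auto simp: continuous_map_in_subtopology)
    show "open_map (subtopology M U) (subtopology euclidean (f ` U)) f"
      unfolding open_map_def
    proof (intro allI impI)
      fix Q assume "openin (subtopology M U) Q"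
      then have Q: "openin M Q" "Q \<subseteq> U"
        using U(1) by (simp_all add: openin_open_subtopology)
      show "openin (subtopology euclidean (f ` U)) (f ` Q)"
        using image_open[OF Q] Q(2) by (simp add: openin_open_eq image_open[OF U(1)] image_mono)
    qed
    show "f ` topspace (subtopology M U) = topspace (subtopology euclidean (f ` U))"
      using top by simp
    have "inj_on (?h \<circ> snd c) U"
      by (rule comp_inj_on[OF inj_on_subset[OF chart_inj[OF c(1)] U(3)] inj_on_subset[OF r(3)]])
        (auto simp: U_def)
    then show "inj_on f (topspace (subtopology M U))"
      unfolding top by (subst inj_on_cong[where g = "?h \<circ> snd c"]) (use f_eq U(3) in auto)
  qed
  then have "local_homeomorphism_at M euclidean f x"
    unfolding local_homeomorphism_at_def using U image_open[OF U(1)] by (intro exI[of _ U]) auto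
  moreover have "x \<in> topspace M"
    using c covering by blast
  ultimately show ?thesis
    by (simp add: branch_set_def)
qed

section \<open>Curves through the exponential map, and coordinates of tangent vectors\<close>

lemma exponential_map_eventually:
  assumes e: "exponential_map_at A x e" and x: "x \<in> topspace M" and v: "v \<in> tangent_space A x"
    and W: "openin M W" "x \<in> W"
  shows "\<forall>\<^sub>F t in nhds 0. e (t *\<^sub>R v) \<in> W"
proof -
  obtain c where c: "c \<in> A" "x \<in> fst c"
    using x covering by blast
  define e' where "e' = e \<circ> tangent_vector c x"
  have "e' = e \<circ> the_inv_into (tangent_space A x) (\<lambda>u. u c)"
    by (simp add: e'_def tangent_vector_def fun_eq_iff)
  then obtain V where V: "open V" "0 \<in> V" "e' ` V \<subseteq> fst c" "smooth_on V (snd c \<circ> e')"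
    using e c unfolding exponential_map_at_def Let_def by metis
  have tv: "e (t *\<^sub>R v) = e' (t *\<^sub>R v c)" for t
    using tangent_vector_coord[OF c subspace_scale[OF subspace_tangent_space v, of t]]
    by (simp add: e'_def scaleR_fun_apply)
  have e0: "e' 0 = x"
    using tv[of 0] e by (simp add: exponential_map_at_def)
  have "isCont (\<lambda>t :: real. (snd c \<circ> e') (t *\<^sub>R v c)) 0"
    by (rule isCont_o2[where g = "snd c \<circ> e'"]) (use smooth_on_isCont[OF V(4,2)] in \<open>auto intro!: continuous_intros\<close>)
  then have "((\<lambda>t. (snd c \<circ> e') (t *\<^sub>R v c)) \<longlongrightarrow> snd c x) (nhds 0)"
    using e0 unfolding isCont_iff_tendsto_nhds by simp
  moreover have "open (snd c ` (W \<inter> fst c))" "snd c x \<in> snd c ` (W \<inter> fst c)"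
    using W c openin_Int[OF W(1) openin_chart[OF c(1)]] by (auto intro!: open_chart_image[OF c(1)])
  ultimately have "\<forall>\<^sub>F t in nhds 0. (snd c \<circ> e') (t *\<^sub>R v c) \<in> snd c ` (W \<inter> fst c)"
    by (rule topological_tendstoD)
  moreover have "\<forall>\<^sub>F t in nhds 0. t *\<^sub>R v c \<in> V"
    by (rule topological_tendstoD[OF _ V(1)]) (use V(2) in \<open>auto intro!: tendsto_eq_intros filterlim_ident\<close>)
  ultimately show ?thesis
  \<comment> \<open>The limit only locates the chart coordinates of the curve. Injectivity of the
    chart turns this into membership of the point itself, which requires the curve to lie in the
    chart domain.\<close>
  proof eventually_elim
    case (elim t)
    have "e' (t *\<^sub>R v c) \<in> fst c"
      using V(3) elim(2) by blast
    then show ?case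
      using elim(1) chart_inj[OF c(1)] unfolding tv by (auto dest: inj_onD)
  qed
qed

lemma tangent_vector_add:
  assumes "c \<in> A" "x \<in> fst c"
  shows "tangent_vector c x (v + w) = tangent_vector c x v + tangent_vector c x w"
  by (rule tangent_vector_eqI[OF assms])
    (simp_all add: assms tangent_vector_mem subspace_add[OF subspace_tangent_space] plus_fun_apply)

lemma tangent_vector_scaleR:
  assumes "c \<in> A" "x \<in> fst c"
  shows "tangent_vector c x (r *\<^sub>R w) = r *\<^sub>R tangent_vector c x w"
  by (rule tangent_vector_eqI[OF assms])
    (simp_all add: assms tangent_vector_mem subspace_scale[OF subspace_tangent_space] scaleR_fun_apply)

section \<open>Change of orientation at the singular point\<close>

text \<open>In the coordinates of \<open>c\<close> the curve \<open>l\<close> of the intrinsic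
  derivative becomes a curve \<open>L\<close> of matrices to which \<open>det_opposite_signs\<close>
  applies. For small \<open>t\<close>, \<open>det (L t)\<close> is a positive multiple of the
  Jacobian at \<open>e (t *\<^sub>R v)\<close>, so points of the curve with parameters
  \<open>t\<close> and \<open>- t\<close> have opposite signs.\<close>

lemma opposite_signs_near:
  fixes f :: "'a \<Rightarrow> real ^ 'n"
  assumes f: "smooth_map_on A (topspace M) f" and x: "x \<in> topspace M"
    and odd: "odd (dim (differential_kernel A f x))"
    and v: "v \<in> tangent_space A x" and D: "has_intrinsic_second_derivative M A f x v D"
    and iso: "linear_iso_to_quotient (differential_kernel A f x) UNIV (differential_range A f x) D"
    and c: "c \<in> A" "x \<in> fst c" and N: "openin M N" "x \<in> N"
  shows "\<exists>p\<in>N \<inter> fst c. \<exists>q\<in>N \<inter> fst c. chart_det f c p * chart_det f c q < 0"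
proof -
  let ?T = "tangent_space A" and ?tv = "tangent_vector c"
  let ?F = "tangent_bundle A" and ?F' = "pullback_euclidean_tangent_bundle M :: ('a, real ^ 'n, real ^ 'n) vbundle"
  obtain U \<tau> \<tau>' e ldot where
    t: "trivialization_at M A ?F x U \<tau>" and t': "trivialization_at M A ?F' x U \<tau>'"
    and e: "exponential_map_at A x e"
    and l: "\<forall>u \<in> fibre ?F x. ldot u \<in> fibre ?F' x \<and> (\<forall>(V, \<sigma>) \<in> trivs ?F'. x \<in> V \<longrightarrow>
        ((\<lambda>t. \<sigma> x (\<tau>' (e (t *\<^sub>R v)) (differential A f (e (t *\<^sub>R v))
           (the_inv_into (fibre ?F (e (t *\<^sub>R v))) (\<tau> (e (t *\<^sub>R v))) u)))) has_vector_derivative \<sigma> x (ldot u)) (at 0))"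
    and DD: "\<forall>u \<in> fibre ?F x. differential A f x u = 0 \<longrightarrow> D u = coset (differential A f x ` fibre ?F x) (ldot u)"
    using D unfolding has_intrinsic_second_derivative_def has_intrinsic_derivative_def Let_def by blast
  have fib: "fibre ?F y = ?T y" for y
    by (simp add: tangent_bundle_def)
  have U: "openin M U" "x \<in> U"
    and \<tau>: "\<And>y. y \<in> U \<Longrightarrow> linear_iso_on (?T y) (?T x) (\<tau> y)" and \<tau>x: "\<And>u. u \<in> ?T x \<Longrightarrow> \<tau> x u = u"
    using t unfolding trivialization_at_def fib by blast+
  have \<tau>': "\<And>y. y \<in> U \<Longrightarrow> linear_iso_on UNIV UNIV (\<tau>' y)" and \<tau>'x: "\<And>w. \<tau>' x w = w"
    using t' unfolding trivialization_at_def by (auto simp: pullback_euclidean_tangent_bundle_def)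
  have lin': "linear (\<tau>' y)" if "y \<in> U" for y
    using \<tau>'[OF that] by (simp add: linear_iso_on_def linear_iff)
  define J where "J y = frechet_derivative (f \<circ> chart_inv c) (at (snd c y))" for y
  have J: "differential A f y u = J y (u c)" if "y \<in> fst c" "u \<in> ?T y" for y u
    unfolding J_def by (rule differential_eq[OF f c(1) that])
  have linJ: "linear (J y)" if "y \<in> fst c" for y
    unfolding J_def using smooth_on_differentiable[OF smooth_on_reading[OF f c(1)]] that
    by (intro linear_frechet_derivative) blast
  \<comment> \<open>\<open>Tm y\<close> is the trivialization of the tangent bundle written in the
    coordinates of \<open>c\<close> at \<open>y\<close> and at \<open>x\<close>; \<open>R y\<close>
    is its inverse.\<close>
  define Tm where "Tm y w = \<tau> y (?tv y w) c" for y w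
  define R where "R y w = the_inv_into (?T y) (\<tau> y) (?tv x w) c" for y w
  have linT: "linear (Tm y)" and TR: "Tm y (R y w) = w" and linR: "linear (R y)"
    and detTR: "det (matrix (Tm y)) * det (matrix (R y)) = 1"
    and l_eq: "\<tau>' y (differential A f y (the_inv_into (?T y) (\<tau> y) (?tv x w))) = (\<tau>' y \<circ> J y \<circ> R y) w"
    if y: "y \<in> U" "y \<in> fst c" for y w
  proof -
    have bij: "bij_betw (\<tau> y) (?T y) (?T x)"
      and add: "\<And>u v. u \<in> ?T y \<Longrightarrow> v \<in> ?T y \<Longrightarrow> \<tau> y (u + v) = \<tau> y u + \<tau> y v"
      and scale: "\<And>r u. u \<in> ?T y \<Longrightarrow> \<tau> y (r *\<^sub>R u) = r *\<^sub>R \<tau> y u"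
      using \<tau>[OF y(1)] unfolding linear_iso_on_def by blast+
    have inj: "inj_on (\<tau> y) (?T y)"
      using bij by (rule bij_betw_imp_inj_on)
    have tv: "?tv y w \<in> ?T y" for w
      by (rule tangent_vector_mem[OF c(1) y(2)])
    have \<tau>_mem: "\<tau> y u \<in> ?T x" if "u \<in> ?T y" for u
      using bij that bij_betwE by blast
    show linT: "linear (Tm y)"
      by (rule linearI)
        (simp_all add: Tm_def tangent_vector_add[OF c(1) y(2)] tangent_vector_scaleR[OF c(1) y(2)]
          add tv scale plus_fun_apply scaleR_fun_apply)
    have im: "?tv x w \<in> \<tau> y ` ?T y" for w
      using bij tangent_vector_mem[OF c] by (simp add: bij_betw_imp_surj_on)
    have u: "the_inv_into (?T y) (\<tau> y) (?tv x w) \<in> ?T y" "\<tau> y (the_inv_into (?T y) (\<tau> y) (?tv x w)) = ?tv x w" for w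
      using the_inv_into_into[OF inj im subset_refl] f_the_inv_into_f[OF inj im] by blast+
    have TR: "Tm y (R y w) = w" for w
      by (simp add: Tm_def R_def tangent_vector_coord[OF c(1) y(2) u(1)] u(2) tangent_vector_apply[OF c])
    then show "Tm y (R y w) = w" .
    \<comment> \<open>Solutions of \<open>Tm y z = w\<close> are unique, so linearity passes from
      \<open>Tm y\<close> to \<open>R y\<close>.\<close>
    have RT: "R y w = z" if "Tm y z = w" for w z
    proof -
      have "\<tau> y (?tv y z) = \<tau> y (?tv y (R y w))"
        using that TR[of w] \<tau>_mem tv by (intro tangent_vector_eqI[OF c]) (auto simp: Tm_def)
      then have "?tv y z = ?tv y (R y w)"
        using inj tv by (auto dest: inj_onD)
      then show ?thesis
        using tangent_vector_apply[OF c(1) y(2)] by metis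
    qed
    show linR: "linear (R y)"
      by (rule linearI; rule RT) (simp_all add: linear_add[OF linT] linear_cmul[OF linT] TR)
    have "Tm y \<circ> R y = id"
      by (simp add: fun_eq_iff TR)
    then show "det (matrix (Tm y)) * det (matrix (R y)) = 1"
      using det_matrix_compose[OF linT linR] by (simp add: matrix_id_mat_1)
    show "\<tau>' y (differential A f y (the_inv_into (?T y) (\<tau> y) (?tv x w))) = (\<tau>' y \<circ> J y \<circ> R y) w"
      by (simp add: J[OF y(2) u(1)] R_def)
  qed
  \<comment> \<open>The matrix is defined for every \<open>t\<close>, but it represents the morphism
    only while the curve stays in \<open>U \<inter> fst c\<close>, which holds near
    \<open>t = 0\<close>.\<close>
  define L where "L t = matrix (\<lambda>w. \<tau>' (e (t *\<^sub>R v)) (differential A f (e (t *\<^sub>R v))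
           (the_inv_into (?T (e (t *\<^sub>R v))) (\<tau> (e (t *\<^sub>R v))) (?tv x w))))" for t
  have L_eq: "L t = matrix (\<tau>' y \<circ> J y \<circ> R y)" if "y = e (t *\<^sub>R v)" "y \<in> U" "y \<in> fst c" for t y
    by (simp only: L_def that(1)[symmetric] l_eq[OF that(2,3)])
  have lin3: "linear (\<tau>' y \<circ> J y \<circ> R y)" if "y \<in> U" "y \<in> fst c" for y
    using lin'[OF that(1)] linJ[OF that(2)] linR[OF that] by (intro linear_compose)
  have UU: "openin M (U \<inter> fst c)" "x \<in> U \<inter> fst c"
    using U c openin_chart by blast+
  define d where "d w = ldot (?tv x w)" for w
  have deriv: "((\<lambda>t. L t *v w) has_vector_derivative d w) (at 0)" for w
  proof -
    obtain S where S: "open S" "0 \<in> S" "\<And>t. t \<in> S \<Longrightarrow> e (t *\<^sub>R v) \<in> U \<inter> fst c"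
      using exponential_map_eventually[OF e x v UU] unfolding eventually_nhds by blast
    have "((\<lambda>t. \<tau>' (e (t *\<^sub>R v)) (differential A f (e (t *\<^sub>R v))
           (the_inv_into (?T (e (t *\<^sub>R v))) (\<tau> (e (t *\<^sub>R v))) (?tv x w)))) has_vector_derivative d w) (at 0)"
      using l[unfolded fib, rule_format, OF tangent_vector_mem[OF c, of w]] x
      by (simp add: d_def pullback_euclidean_tangent_bundle_def)
    then show ?thesis
    proof (rule has_vector_derivative_transform_within_open[OF _ S(1,2)])
      fix t assume "t \<in> S"
      then have y: "e (t *\<^sub>R v) \<in> U" "e (t *\<^sub>R v) \<in> fst c"
        using S(3) by blast+
      show "\<tau>' (e (t *\<^sub>R v)) (differential A f (e (t *\<^sub>R v))
           (the_inv_into (?T (e (t *\<^sub>R v))) (\<tau> (e (t *\<^sub>R v))) (?tv x w))) = L t *v w"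
        unfolding L_eq[OF refl y] l_eq[OF y] using fun_cong[OF matrix_vector_mul(2)[OF lin3[OF y]], of w] by simp
    qed
  qed
  have ex: "e (0 *\<^sub>R v) = x"
    using e by (simp add: exponential_map_at_def)
  have Rx: "R x w = w" for w
  proof -
    have "Tm x z = z" for z
      by (simp add: Tm_def \<tau>x tangent_vector_mem[OF c] tangent_vector_apply[OF c])
    then show ?thesis
      using TR[OF U(2) c(2), of w] by metis
  qed
  have L0: "L 0 *v w = J x w" for w
    using fun_cong[OF matrix_vector_mul(2)[OF lin3[OF U(2) c(2)]], of w]
    by (simp add: L_eq[OF ex[symmetric] U(2) c(2)] \<tau>'x Rx)
  have ker: "{w. L 0 *v w = 0} = (\<lambda>u. u c) ` differential_kernel A f x"
  proof (intro equalityI subsetI)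
    fix w assume "w \<in> {w. L 0 *v w = 0}"
    then have "?tv x w \<in> differential_kernel A f x"
      by (simp add: differential_kernel_def tangent_vector_mem[OF c] J[OF c(2)] L0 tangent_vector_apply[OF c])
    then show "w \<in> (\<lambda>u. u c) ` differential_kernel A f x"
      by (rule rev_image_eqI) (simp add: tangent_vector_apply[OF c])
  next
    fix w assume "w \<in> (\<lambda>u. u c) ` differential_kernel A f x"
    then show "w \<in> {w. L 0 *v w = 0}"
      by (auto simp: differential_kernel_def L0 J[OF c(2)])
  qed
  have "subspace (differential_kernel A f x)"
  proof -
    note T = subspace_tangent_space[of x]
    have mem: "u \<in> differential_kernel A f x \<longleftrightarrow> u \<in> ?T x \<and> J x (u c) = 0" for u
      using J[OF c(2)] by (auto simp: differential_kernel_def)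
    show ?thesis
      using subspace_0[OF T] subspace_add[OF T] subspace_scale[OF T]
      by (intro subspaceI)
        (simp_all add: mem scaleR_fun_apply
          linear_0[OF linJ[OF c(2)]] linear_add[OF linJ[OF c(2)]] linear_cmul[OF linJ[OF c(2)]])
  qed
  moreover have "inj_on (\<lambda>u. u c) (differential_kernel A f x)"
    by (rule inj_onI, rule tangent_vector_eqI[OF c]) (auto simp: differential_kernel_def)
  ultimately have odd': "odd (dim {w. L 0 *v w = 0})"
    using odd unfolding ker by (simp add: dim_image_inj_on linear_evaluation)
  have range: "differential A f x ` ?T x = range (J x)"
  proof (intro equalityI subsetI)
    fix z assume "z \<in> range (J x)"
    then obtain w where "z = J x w" by blast
    then have "z = differential A f x (?tv x w)"
      by (simp add: J[OF c(2)] tangent_vector_mem[OF c] tangent_vector_apply[OF c])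
    then show "z \<in> differential A f x ` ?T x"
      using tangent_vector_mem[OF c] by blast
  qed (auto simp: J[OF c(2)])
  \<comment> \<open>If \<open>d w\<close> is in the range of the differential, then \<open>D\<close>
    sends both the vector with coordinates \<open>w\<close> and the zero vector to the zero coset.
    Injectivity of \<open>D\<close> on the kernel then gives \<open>w = 0\<close>.\<close>
  have inj: "w = 0" if w: "L 0 *v w = 0" "d w \<in> range ((*v) (L 0))" for w
  proof -
    have ker_tv: "?tv x w \<in> differential_kernel A f x" if "L 0 *v w = 0" for w
      using that by (simp add: differential_kernel_def tangent_vector_mem[OF c] J[OF c(2)] L0 tangent_vector_apply[OF c])
    have D_eq: "D (?tv x w) = coset (range (J x)) (d w)" if "L 0 *v w = 0" for w
      using DD[unfolded fib range] ker_tv[OF that] by (simp add: differential_kernel_def d_def)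
    have "d 0 = 0"
      using vector_derivative_unique_at[OF deriv[of 0]] by simp
    moreover have "d w \<in> range (J x)"
      using w(2) by (simp add: L0 image_def)
    moreover have "coset (range (J x)) z = coset (range (J x)) 0" if z: "z \<in> range (J x)" for z
    proof -
      obtain a where a: "z = J x a"
        using z by (rule rangeE)
      have "z + J x b = 0 + J x (a + b)" "0 + J x b = z + J x (b - a)" for b
        by (simp_all add: a linear_add[OF linJ[OF c(2)]] linear_diff[OF linJ[OF c(2)]])
      then show ?thesis
        unfolding coset_def by blast
    qed
    ultimately have "D (?tv x w) = D (?tv x 0)"
      using D_eq[OF w(1)] D_eq[of 0] by simp
    then have "?tv x w = ?tv x 0"
      using iso ker_tv[OF w(1)] ker_tv[of 0] unfolding linear_iso_to_quotient_def
      by (auto dest: bij_betw_imp_inj_on inj_onD)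
    then show ?thesis
      using tangent_vector_apply[OF c] by metis
  qed
  have signs: "\<forall>\<^sub>F t in at_right 0. det (L t) * det (L (- t)) < 0"
    by (rule det_opposite_signs[OF deriv odd' inj])
  \<comment> \<open>Both trivializations are the identity at \<open>x\<close> and vary continuously,
    so their determinants tend to 1 and are positive near \<open>x\<close>.\<close>
  let ?P = "\<lambda>y. y \<in> N \<inter> U \<and> det (matrix (Tm y)) > 0 \<and> det (matrix (\<tau>' y)) > 0"
  have cx: "snd c x \<in> snd c ` (fst c \<inter> (U \<inter> fst c))"
    using c U by blast
  have det1: "det (matrix (\<lambda>w :: real ^ 'n. w)) = 1"
    by (simp add: matrix_id_mat_1[unfolded id_def])
  have smT: "smooth_map_on A (U \<inter> fst c) (\<lambda>y. Tm y w)" for w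
  proof -
    have mem: "(fst c, \<lambda>y u. u c) \<in> trivs ?F"
      unfolding tangent_bundle_def by (simp only: vbundle.simps) (use c(1) in blast)
    have smooth: "\<forall>(V, \<sigma>) \<in> trivs ?F. \<forall>(W, \<rho>) \<in> trivs ?F. x \<in> W \<longrightarrow>
        (\<forall>w. smooth_map_on A (U \<inter> V) (\<lambda>y. \<rho> x (\<tau> y (the_inv_into (fibre ?F y) (\<sigma> y) w))))"
      using t unfolding trivialization_at_def by (elim conjE)
    show ?thesis
      using bspec[OF bspec[OF smooth mem, unfolded prod.case] mem, unfolded prod.case] c(2)
      by (simp add: Tm_def fib tangent_vector_def)
  qed
  \<comment> \<open>The only given trivialization of the pullback bundle is the identity over all of
    \<open>M\<close>, so smoothness of the bundle trivialization can be read off from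
    \<open>\<tau>'\<close> directly.\<close>
  have smT': "smooth_map_on A (U \<inter> topspace M) (\<lambda>y. \<tau>' y w)" for w
  proof -
    have "the_inv_into UNIV (\<lambda>w :: real ^ 'n. w) w = w" for w
      by (rule the_inv_into_f_eq) auto
    then show ?thesis
      using t' x unfolding trivialization_at_def by (simp add: pullback_euclidean_tangent_bundle_def)
  qed
  have lim: "((\<lambda>p. Tm (chart_inv c p) w) \<longlongrightarrow> w) (nhds (snd c x))" for w
  proof -
    have "isCont ((\<lambda>y. Tm y w) \<circ> chart_inv c) (snd c x)"
      using smT[of w] c(1) unfolding smooth_map_on_def by (intro smooth_on_isCont[OF _ cx]) blast
    moreover have "Tm x w = w"
      by (simp add: Tm_def \<tau>x tangent_vector_mem[OF c] tangent_vector_apply[OF c])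
    ultimately show ?thesis
      unfolding isCont_iff_tendsto_nhds using c by (simp add: o_def)
  qed
  have lim': "((\<lambda>p. \<tau>' (chart_inv c p) w) \<longlongrightarrow> w) (nhds (snd c x))" for w
  proof -
    have "isCont ((\<lambda>y. \<tau>' y w) \<circ> chart_inv c) (snd c x)"
      using smT'[of w] c U x unfolding smooth_map_on_def by (intro smooth_on_isCont[of "snd c ` (fst c \<inter> (U \<inter> topspace M))"]) auto
    then show ?thesis
      unfolding isCont_iff_tendsto_nhds using c \<tau>'x by (simp add: o_def)
  qed
  have "\<forall>\<^sub>F p in nhds (snd c x). det (matrix (Tm (chart_inv c p))) > 0"
    using tendsto_det_matrix[OF lim] by (rule order_tendstoD(1)) (simp add: det1)
  moreover have "\<forall>\<^sub>F p in nhds (snd c x). det (matrix (\<tau>' (chart_inv c p))) > 0"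
    using tendsto_det_matrix[OF lim'] by (rule order_tendstoD(1)) (simp add: det1)
  moreover have "\<forall>\<^sub>F p in nhds (snd c x). p \<in> snd c ` (fst c \<inter> (N \<inter> U))"
    by (rule eventually_nhds_in_open)
      (use open_chart_image[OF c(1), of "fst c \<inter> (N \<inter> U)"] openin_chart[OF c(1)] N U c in auto)
  ultimately have "\<forall>\<^sub>F p in nhds (snd c x). ?P (chart_inv c p)"
    by eventually_elim (use c in auto)
  then obtain W where W: "openin M W" "x \<in> W" "W \<subseteq> fst c" "\<And>y. y \<in> W \<Longrightarrow> ?P y"
    using eventually_chart_imp_neighbourhood[OF c, of ?P] by blast
  have sign_eq: "\<exists>k>0. det (L t) = k * chart_det f c (e (t *\<^sub>R v))" if "e (t *\<^sub>R v) \<in> W" for t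
  proof -
    let ?y = "e (t *\<^sub>R v)"
    have y: "?y \<in> U" "?y \<in> fst c" and pos: "det (matrix (Tm ?y)) > 0" "det (matrix (\<tau>' ?y)) > 0"
      using W(3) W(4)[OF that] that by auto
    have "det (matrix (R ?y)) > 0"
      using detTR[OF y] pos(1) by (metis zero_less_mult_pos zero_less_one)
    moreover have "det (L t) = det (matrix (\<tau>' ?y)) * det (matrix (J ?y)) * det (matrix (R ?y))"
      unfolding L_eq[OF refl y]
      by (simp only: det_matrix_compose lin'[OF y(1)] linJ[OF y(2)] linR[OF y] linear_compose)
    ultimately show ?thesis
      using pos(2) by (intro exI[of _ "det (matrix (\<tau>' ?y)) * det (matrix (R ?y))"]) (simp add: chart_det_def J_def)
  qed
  have ev: "\<forall>\<^sub>F t in nhds 0. e (t *\<^sub>R v) \<in> W"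
    by (rule exponential_map_eventually[OF e x v W(1,2)])
  have "\<forall>\<^sub>F t in at_right 0. e (t *\<^sub>R v) \<in> W"
    using ev by (simp add: eventually_at_filter eventually_mono)
  moreover have "\<forall>\<^sub>F t in at_right 0. e ((- t) *\<^sub>R v) \<in> W"
  proof -
    have "filterlim (\<lambda>t :: real. - t) (nhds 0) (at_right 0)"
      by (rule tendsto_eq_intros | simp)+
    then show ?thesis
      by (rule eventually_compose_filterlim[OF ev])
  qed
  ultimately have "\<forall>\<^sub>F t in at_right 0. e (t *\<^sub>R v) \<in> W \<and> e ((- t) *\<^sub>R v) \<in> W \<and> det (L t) * det (L (- t)) < 0"
    using signs by eventually_elim simp
  then obtain t where t: "e (t *\<^sub>R v) \<in> W" "e ((- t) *\<^sub>R v) \<in> W" "det (L t) * det (L (- t)) < 0"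
    using eventually_happens[of _ "at_right (0 :: real)"] by auto
  obtain k where k: "k > 0" "det (L t) = k * chart_det f c (e (t *\<^sub>R v))"
    using sign_eq[OF t(1)] by blast
  obtain k' where k': "k' > 0" "det (L (- t)) = k' * chart_det f c (e ((- t) *\<^sub>R v))"
    using sign_eq[OF t(2)] by blast
  have "(k * k') * (chart_det f c (e (t *\<^sub>R v)) * chart_det f c (e ((- t) *\<^sub>R v))) < 0"
    using t(3) unfolding k(2) k'(2) by (simp only: mult_ac)
  then have "chart_det f c (e (t *\<^sub>R v)) * chart_det f c (e ((- t) *\<^sub>R v)) < 0"
    using k(1) k'(1) mult_pos_pos[OF k(1) k'(1)] by (metis mult_less_0_iff not_less_iff_gr_or_eq)
  moreover have "e (t *\<^sub>R v) \<in> N \<inter> fst c" "e ((- t) *\<^sub>R v) \<in> N \<inter> fst c"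
    using W(3) W(4) t(1,2) by blast+
  ultimately show ?thesis
    by blast
qed

end

section \<open>Separation by the branch set\<close>

theorem theorem2p6:
  fixes M :: "'a topology" and A :: "('a, 'n::finite) chart set"
    and f :: "'a \<Rightarrow> real ^ 'n" and x :: 'a
  assumes "smooth_manifold M A" and "connected_space M" and "orientable M A"
    and "smooth_map_on A (topspace M) f" and "proper_map M euclidean f"
    and "x \<in> topspace M"
    and "odd (dim (differential_kernel A f x))"
    and "\<exists>v \<in> tangent_space A x. \<exists>D. has_intrinsic_second_derivative M A f x v D \<and>
           linear_iso_to_quotient (differential_kernel A f x) UNIV (differential_range A f x) D"
  shows "x \<in> branch_set M f \<and>
    (\<forall>N. openin M N \<and> x \<in> N \<longrightarrow>
      (\<exists>x1\<in>N. \<exists>x2\<in>N. regular_point M A f x1 \<and> regular_point M A f x2 \<and>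
        (\<exists>P \<in> path_components_of (subtopology M (topspace M - branch_set M f)).
         \<exists>Q \<in> path_components_of (subtopology M (topspace M - branch_set M f)).
           P \<noteq> Q \<and> x1 \<in> P \<and> x2 \<in> Q) \<and>
        (\<forall>g. pathin M g \<and> g 0 = x1 \<and> g 1 = x2 \<longrightarrow> g ` {0..1} \<inter> branch_set M f \<noteq> {})))"
proof -
  interpret A: smooth_manifold M A by fact
  note f = assms(4) and x = assms(6)
  obtain v D where v: "v \<in> tangent_space A x" and D: "has_intrinsic_second_derivative M A f x v D"
    "linear_iso_to_quotient (differential_kernel A f x) UNIV (differential_range A f x) D"
    using assms(8) by blast
  obtain B where B: "smooth_manifold M B" "smooth_manifold M (A \<union> B)"
    and orient: "\<forall>c\<in>B. \<forall>c'\<in>B. \<forall>y \<in> snd c ` (fst c \<inter> fst c').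
        det (matrix (frechet_derivative (transition c c') (at y))) > 0"
    using assms(3) unfolding orientable_def by blast
  interpret AB: smooth_manifold M "A \<union> B" by fact
  have diffA: "(f \<circ> chart_inv c) differentiable (at (snd c y))" if "c \<in> A" "y \<in> fst c" for c y
    using smooth_on_differentiable[OF A.smooth_on_reading[OF f that(1)]] that(2) by blast
  \<comment> \<open>Smoothness of \<open>f\<close> is known in the charts of \<open>A\<close>;
    compatibility of the two atlases carries differentiability to those of \<open>B\<close>.\<close>
  have diffB: "(f \<circ> chart_inv b) differentiable (at (snd b y))" if "b \<in> B" "y \<in> fst b" for b y
  proof -
    interpret B: smooth_manifold M B by fact
    have "y \<in> topspace M"
      using that B.covering by blast
    then obtain c where "c \<in> A" "y \<in> fst c"
      using A.covering by blast
    then show ?thesis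
      using that diffA by (intro AB.reading_differentiable_change_chart[of b c]) auto
  qed
  interpret B: oriented_manifold_map M B f
  proof (intro oriented_manifold_map.intro B(1) oriented_manifold_map_axioms.intro diffB)
    fix c c' y assume c: "c \<in> B" "c' \<in> B" "y \<in> fst c" "y \<in> fst c'"
    then have "snd c y \<in> snd c ` (fst c \<inter> fst c')"
      by blast
    then show "chart_det (snd c') c y > 0"
      using orient c(1,2) unfolding chart_det_def by blast
  qed
  obtain c where c: "c \<in> A" "x \<in> fst c"
    using x A.covering by blast
  obtain b where b: "b \<in> B" "x \<in> fst b"
    using x B.covering by blast
  have cb: "c \<in> A \<union> B" "b \<in> A \<union> B"
    using c b by blast+
  obtain W where W: "openin M W" "x \<in> W" "W \<subseteq> fst c" "W \<subseteq> fst b"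
    "\<forall>y\<in>W. chart_det (snd b) c y * chart_det (snd b) c x > 0"
    by (rule AB.chart_det_transition_sign[OF cb c(2) b(2)])
  \<comment> \<open>Both charts are needed: nonzero Jacobians in \<open>c\<close> give regular
    points with respect to \<open>A\<close>, and opposite signs in the oriented chart
    \<open>b\<close> give the separation.\<close>
  have near: "\<exists>p\<in>N \<inter> W. \<exists>q\<in>N \<inter> W. chart_det f c p \<noteq> 0 \<and> chart_det f c q \<noteq> 0 \<and>
      chart_det f b p * chart_det f b q < 0" if N: "openin M N" "x \<in> N" for N
  proof -
    have "openin M (N \<inter> W)" "x \<in> N \<inter> W"
      using N W by blast+
    then obtain p q where pq: "p \<in> N \<inter> W" "q \<in> N \<inter> W" "chart_det f c p * chart_det f c q < 0"
      using A.opposite_signs_near[OF f x assms(7) v D c] by blast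
    have change: "chart_det f c y = chart_det f b y * chart_det (snd b) c y" if "y \<in> W" for y
      using that W(3,4) diffB[OF b(1)] by (intro AB.chart_det_change_chart[OF cb]) auto
    \<comment> \<open>Whether \<open>c\<close> agrees with the orientation is unknown, but the sign
      of the transition at \<open>x\<close> enters squared and cancels from the product.\<close>
    let ?d = "chart_det (snd b) c"
    have "?d p * ?d x > 0" "?d q * ?d x > 0"
      using pq(1,2) W(5) by blast+
    then have "(?d p * ?d x) * (?d q * ?d x) > 0"
      by (rule mult_pos_pos)
    then have "(?d p * ?d q) * (?d x * ?d x) > 0"
      by (simp only: mult_ac)
    moreover have "?d x * ?d x > 0"
      using W(2,5) by blast
    ultimately have "?d p * ?d q > 0"
      by (rule zero_less_mult_pos2)
    moreover have "(chart_det f b p * chart_det f b q) * (?d p * ?d q) < 0"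
      using pq(3) change[of p] change[of q] pq(1,2) by (simp add: mult_ac)
    ultimately have "chart_det f b p * chart_det f b q < 0"
      using mult_nonneg_nonneg less_imp_le not_le by metis
    moreover have "chart_det f c p \<noteq> 0" "chart_det f c q \<noteq> 0"
      using pq(3) by auto
    ultimately show ?thesis
      using pq(1,2) by blast
  qed
  \<comment> \<open>At a non-branch point one weak sign would hold on a whole neighbourhood, whereas
    \<open>near\<close> yields both strict signs in it.\<close>
  have "x \<in> branch_set M f"
  proof (rule ccontr)
    assume "x \<notin> branch_set M f"
    then have "x \<in> topspace M - branch_set M f"
      using x by blast
    then obtain s V where V: "s = 1 \<or> s = (-1::real)" "openin M V" "x \<in> V"
      "\<forall>z\<in>V. \<forall>c\<in>B. z \<in> fst c \<longrightarrow> 0 \<le> s * chart_det f c z"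
      by (rule B.not_branch_point_imp_sign)
    obtain p q where pq: "p \<in> V" "q \<in> V" "p \<in> fst b" "q \<in> fst b" "chart_det f b p * chart_det f b q < 0"
      using near[OF V(2,3)] W(4) by blast
    have "0 \<le> s * chart_det f b p" "0 \<le> s * chart_det f b q"
      using V(4) b(1) pq(1-4) by blast+
    then show False
      using V(1) pq(5) by (auto simp: mult_less_0_iff)
  qed
  moreover have "\<exists>x1\<in>N. \<exists>x2\<in>N. regular_point M A f x1 \<and> regular_point M A f x2 \<and>
        (\<exists>P \<in> path_components_of (subtopology M (topspace M - branch_set M f)).
         \<exists>Q \<in> path_components_of (subtopology M (topspace M - branch_set M f)).
           P \<noteq> Q \<and> x1 \<in> P \<and> x2 \<in> Q) \<and>
        (\<forall>g. pathin M g \<and> g 0 = x1 \<and> g 1 = x2 \<longrightarrow> g ` {0..1} \<inter> branch_set M f \<noteq> {})"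
    if N: "openin M N" "x \<in> N" for N
  proof -
    obtain x1 x2 where X: "x1 \<in> N" "x2 \<in> N" "x1 \<in> W" "x2 \<in> W"
      "chart_det f c x1 \<noteq> 0" "chart_det f c x2 \<noteq> 0" "chart_det f b x1 * chart_det f b x2 < 0"
      using near[OF N] by blast
    have cx: "x1 \<in> fst c" "x2 \<in> fst c" and bx: "x1 \<in> fst b" "x2 \<in> fst b"
      using X(3,4) W(3,4) by blast+
    let ?X = "subtopology M (topspace M - branch_set M f)"
    have mem: "x1 \<in> topspace ?X" "x2 \<in> topspace ?X"
      using A.nonsingular_imp_not_branch_point[OF f c(1)] cx X(5,6) by auto
    have meet: "g ` {0..1} \<inter> branch_set M f \<noteq> {}" if "pathin M g" "g 0 = x1" "g 1 = x2" for g
      by (rule B.path_meets_branch_set[OF b(1) bx(1) b(1) bx(2) X(7) that])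
    have "\<not> path_component_of ?X x1 x2"
    proof
      assume "path_component_of ?X x1 x2"
      then obtain g where g: "pathin ?X g" "g 0 = x1" "g 1 = x2"
        unfolding path_component_of_def by blast
      then have "pathin M g" "g ` {0..1} \<inter> branch_set M f = {}"
        by (auto simp: pathin_subtopology)
      then show False
        using meet g(2,3) by blast
    qed
    moreover have "path_component_of ?X x1 x1" "path_component_of ?X x2 x2"
      using mem by (simp_all add: path_component_of_refl)
    ultimately have "Collect (path_component_of ?X x1) \<noteq> Collect (path_component_of ?X x2)"
      "x1 \<in> Collect (path_component_of ?X x1)" "x2 \<in> Collect (path_component_of ?X x2)"
      by blast+
    then have "\<exists>P \<in> path_components_of ?X. \<exists>Q \<in> path_components_of ?X. P \<noteq> Q \<and> x1 \<in> P \<and> x2 \<in> Q"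
      unfolding path_components_of_def using mem
      by (intro bexI[of _ "Collect (path_component_of ?X x1)"] bexI[of _ "Collect (path_component_of ?X x2)"] conjI imageI)
    moreover have "regular_point M A f x1" "regular_point M A f x2"
      using A.regular_pointI[OF f c(1)] cx X(5,6) by simp_all
    moreover have "\<forall>g. pathin M g \<and> g 0 = x1 \<and> g 1 = x2 \<longrightarrow> g ` {0..1} \<inter> branch_set M f \<noteq> {}"
      using meet by simp
    ultimately show ?thesis
      by (intro bexI[OF _ X(1)] bexI[OF _ X(2)] conjI)
  qed
  ultimately show ?thesis
    by (intro conjI allI impI) simp_all
qed

end
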